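(* Let $Z\subset K$ be a compact clopen set, $\mathcal{U}$ a verticial covering of $Z$, $A=(A_{UV})$ a symmetric $\mathcal{U}$-matrix with non-negative real entries and $A_{UU}=0$ for all $U\in\mathcal{U}$, $\alpha\in\mathbb{R}$ and $\epsilon>0$. Then there exists a probability measure $p_t(x,\cdot)$, for $t\ge0$, $x\in Z$, on the Borel $\sigma$-algebra of $Z$ such that for fixed $h_0\in C(Z)$ the Cauchy problem of finding $h(t,x)\in C^1([0,\infty),C(Z))$ with $$\left(\frac{\partial}{\partial t}-\epsilon\,\mathcal{D}^\alpha_{A,\mathcal{U}}\right)h(t,x)=0\quad (t\ge0,\ x\in Z),\qquad h(0,x)=h_0(x),$$ has a unique solution, and it is of the form $$h(t,x)=\int_Z h_0(y)\,p_t(x,dy).$$ In addition, $p_t(x,\cdot)$ is the transition function of a Markov process whose paths are right continuous and have no discontinuities other than jumps.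
   Context: $K$ is a non-archimedean local field with absolute value $|\cdot|_K$, Haar measure $\mu$ (also $dx$) with $\mu(O_K)=1$. $C(Z)$ is the Banach space of continuous real-valued functions on $Z$ with the sup norm. $1_U$ is the indicator function of $U$. A verticial covering of $Z$ is a covering by mutually disjoint holed discs (discs of $K$ with finitely many pairwise disjoint subdiscs removed), each of which is an intersection of spheres $\{x:|x-a|_K=r\}$ of equal radius $r$ (which may depend on the member). A $\mathcal{U}$-matrix is a matrix indexed by $\mathcal{U}$. The operator is $\mathcal{D}^\alpha_{A,\mathcal{U}}f(x)=\int_Z A^\alpha_{\mathcal{U}}(x,y)(f(y)-f(x))\,dy$ with kernel $A^\alpha_{\mathcal{U}}(x,y)=\sum_{U,V\in\mathcal{U}}A_{UV}|x-y|_K^\alpha 1_U(x)1_V(y)$. *)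

theory Defs
  imports "HOL-Probability.Probability"
begin

section \<open>Non-archimedean local fields\<close>

text \<open>The topology of the type is the one defined by the absolute value. The absolute value is not
  assumed to be the normalised one (the module of the Haar measure).\<close>

locale nonarch_local_field =
  fixes absK :: "'a::{field,metric_space} \<Rightarrow> real"
  assumes abs_nonneg: "0 \<le> absK x"
    and abs_eq_0_iff: "absK x = 0 \<longleftrightarrow> x = 0"
    and abs_mult: "absK (x * y) = absK x * absK y"
    and abs_ultrametric: "absK (x + y) \<le> max (absK x) (absK y)"
    and abs_nontrivial: "\<exists>x. x \<noteq> 0 \<and> absK x \<noteq> 1"
    and dist_abs: "dist x y = absK (x - y)"
    and locally_compact: "locally_compact_space (euclidean :: 'a topology)"

text \<open>The Haar measure of the additive group, normalised to total mass 1 on the ring of integers.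
  Radon regularity is automatic here, since the field is a locally compact, sigma-compact metric
  space.\<close>

definition normalized_haar_measure ::
  "('a::{field,metric_space} \<Rightarrow> real) \<Rightarrow> 'a measure \<Rightarrow> bool"
where
  "normalized_haar_measure absK \<mu> \<longleftrightarrow>
     sets \<mu> = sets borel \<and>
     (\<forall>B\<in>sets borel. \<forall>c. emeasure \<mu> ((\<lambda>x. c + x) ` B) = emeasure \<mu> B) \<and>
     (\<forall>C. compact C \<longrightarrow> emeasure \<mu> C < \<infinity>) \<and>
     emeasure \<mu> {x. absK x \<le> 1} = 1"

section \<open>Verticial coverings\<close>

text \<open>Since the valuation is discrete, discs given by a strict inequality are also of the following
  form.\<close>

definition is_disc :: "('a::field \<Rightarrow> real) \<Rightarrow> 'a set \<Rightarrow> bool" where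
  "is_disc absK D \<longleftrightarrow> (\<exists>a r. r > 0 \<and> D = {x. absK (x - a) \<le> r})"

definition is_holed_disc :: "('a::field \<Rightarrow> real) \<Rightarrow> 'a set \<Rightarrow> bool" where
  "is_holed_disc absK U \<longleftrightarrow>
     (\<exists>D \<H>. is_disc absK D \<and> finite \<H> \<and> disjoint \<H> \<and>
        (\<forall>H\<in>\<H>. is_disc absK H \<and> H \<subseteq> D) \<and> U = D - \<Union>\<H>)"

definition is_sphere_intersection :: "('a::field \<Rightarrow> real) \<Rightarrow> 'a set \<Rightarrow> bool" where
  "is_sphere_intersection absK U \<longleftrightarrow>
     (\<exists>r S. r > 0 \<and> S \<noteq> {} \<and> U = (\<Inter>a\<in>S. {x. absK (x - a) = r}))"

text \<open>Finiteness of a verticial covering of a compact set is automatic: holed discs are open.\<close>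

definition verticial_covering :: "('a::field \<Rightarrow> real) \<Rightarrow> 'a set set \<Rightarrow> 'a set \<Rightarrow> bool" where
  "verticial_covering absK \<U> Z \<longleftrightarrow>
     \<Union>\<U> = Z \<and> disjoint \<U> \<and>
     (\<forall>U\<in>\<U>. is_holed_disc absK U \<and> is_sphere_intersection absK U)"

section \<open>The integral operator\<close>

text \<open>On the diagonal, where \<^term>\<open>0 powr \<alpha> = (0::real)\<close> is a convention, the kernel is multiplied by
  \<^term>\<open>A U U\<close>, which is zero in the application.\<close>

definition kernel ::
  "('a::field \<Rightarrow> real) \<Rightarrow> real \<Rightarrow> ('a set \<Rightarrow> 'a set \<Rightarrow> real) \<Rightarrow> 'a set set \<Rightarrow> 'a \<Rightarrow> 'a \<Rightarrow> real"
where
  "kernel absK \<alpha> A \<U> x y =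
     (\<Sum>U\<in>\<U>. \<Sum>V\<in>\<U>. A U V * absK (x - y) powr \<alpha> * indicator U x * indicator V y)"

definition diff_op ::
  "('a::field \<Rightarrow> real) \<Rightarrow> 'a measure \<Rightarrow> 'a set \<Rightarrow> real \<Rightarrow> ('a set \<Rightarrow> 'a set \<Rightarrow> real) \<Rightarrow> 'a set set
    \<Rightarrow> ('a \<Rightarrow> real) \<Rightarrow> 'a \<Rightarrow> real"
where
  "diff_op absK \<mu> Z \<alpha> A \<U> f x = (LINT y:Z|\<mu>. kernel absK \<alpha> A \<U> x y * (f y - f x))"

section \<open>The Cauchy problem\<close>

text \<open>\<^term>\<open>has_C1_derivative Z h h'\<close>: the curve \<^term>\<open>h\<close>, restricted to \<open>t \<ge> 0\<close>, belongs to
  \<open>C\<^sup>1([0,\<infinity>), C(Z))\<close> and has derivative \<^term>\<open>h'\<close>. Elements of \<open>C(Z)\<close> are represented by functions on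
  the whole type, whose values outside \<^term>\<open>Z\<close> are irrelevant; convergence in the sup norm of
  \<open>C(Z)\<close> is uniform convergence on \<^term>\<open>Z\<close>.\<close>

definition has_C1_derivative ::
  "'a::topological_space set \<Rightarrow> (real \<Rightarrow> 'a \<Rightarrow> real) \<Rightarrow> (real \<Rightarrow> 'a \<Rightarrow> real) \<Rightarrow> bool"
where
  "has_C1_derivative Z h h' \<longleftrightarrow>
     (\<forall>t\<ge>0. continuous_on Z (h t) \<and> continuous_on Z (h' t) \<and>
        uniform_limit Z (\<lambda>s x. (h s x - h t x) / (s - t)) (h' t) (at t within {0..}) \<and>
        uniform_limit Z h' (h' t) (at t within {0..}))"

definition cauchy_solution ::
  "'a::topological_space set \<Rightarrow> (('a \<Rightarrow> real) \<Rightarrow> 'a \<Rightarrow> real) \<Rightarrow> ('a \<Rightarrow> real)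
    \<Rightarrow> (real \<Rightarrow> 'a \<Rightarrow> real) \<Rightarrow> bool"
where
  "cauchy_solution Z L h0 h \<longleftrightarrow>
     (\<exists>h'. has_C1_derivative Z h h' \<and>
        (\<forall>t\<ge>0. \<forall>x\<in>Z. h' t x - L (h t) x = 0) \<and>
        (\<forall>x\<in>Z. h 0 x = h0 x))"

section \<open>Markov processes\<close>

text \<open>A conservative, time-homogeneous Markov transition function on the measurable space
  \<^term>\<open>S\<close>; measurability into \<^const>\<open>prob_algebra\<close> says that each \<^term>\<open>p t x\<close> is a probability measure
  on \<^term>\<open>S\<close> which depends measurably on \<^term>\<open>x\<close>.\<close>

definition markov_transition_function :: "'s measure \<Rightarrow> (real \<Rightarrow> 's \<Rightarrow> 's measure) \<Rightarrow> bool" where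
  "markov_transition_function S p \<longleftrightarrow>
     (\<forall>t\<ge>0. p t \<in> S \<rightarrow>\<^sub>M prob_algebra S) \<and>
     (\<forall>x\<in>space S. p 0 x = return S x) \<and>
     (\<forall>s\<ge>0. \<forall>t\<ge>0. \<forall>x\<in>space S. \<forall>B\<in>sets S.
        emeasure (p (s + t) x) B = (\<integral>\<^sup>+y. emeasure (p t y) B \<partial>p s x))"

text \<open>A Markov process \<open>(\<Omega>, F, F\<^sub>t, P\<^sub>x, X\<^sub>t)\<close> with state space \<^term>\<open>S\<close> and transition function
  \<^term>\<open>p\<close>. Only the space and the sigma-algebra of \<^term>\<open>M\<close> are used. The time parameter is
  \<open>t \<ge> 0\<close>; the values of \<^term>\<open>F\<close>, \<^term>\<open>X\<close> and \<^term>\<open>p\<close> at negative times carry no information.\<close>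

definition markov_process ::
  "'s measure \<Rightarrow> (real \<Rightarrow> 's \<Rightarrow> 's measure) \<Rightarrow> 'w measure \<Rightarrow> (real \<Rightarrow> 'w measure)
    \<Rightarrow> ('s \<Rightarrow> 'w measure) \<Rightarrow> (real \<Rightarrow> 'w \<Rightarrow> 's) \<Rightarrow> bool"
where
  "markov_process S p M F P X \<longleftrightarrow>
     markov_transition_function S p \<and>
     filtration (space M) F \<and>
     (\<forall>t\<ge>0. subalgebra M (F t) \<and> X t \<in> F t \<rightarrow>\<^sub>M S) \<and>
     (\<forall>x\<in>space S.
        prob_space (P x) \<and> sets (P x) = sets M \<and>
        (AE \<omega> in P x. X 0 \<omega> = x) \<and>
        (\<forall>t\<ge>0. distr (P x) S (X t) = p t x) \<and>
        (\<forall>s\<ge>0. \<forall>t\<ge>0. \<forall>B\<in>sets S. AE \<omega> in P x.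
           real_cond_exp (P x) (F s) (indicator (X (s + t) -` B \<inter> space M)) \<omega>
             = measure (p t (X s \<omega>)) B))"

text \<open>Right continuity on \<open>[0,\<infinity>)\<close>, and at each \<open>t > 0\<close> a left limit in the state space \<^term>\<open>Z\<close>, so
  that every discontinuity is a jump.\<close>

definition cadlag_path :: "'s::topological_space set \<Rightarrow> (real \<Rightarrow> 's) \<Rightarrow> bool" where
  "cadlag_path Z \<gamma> \<longleftrightarrow>
     (\<forall>t\<ge>0. \<gamma> t \<in> Z \<and> (\<gamma> \<longlongrightarrow> \<gamma> t) (at_right t)) \<and>
     (\<forall>t>0. \<exists>l\<in>Z. (\<gamma> \<longlongrightarrow> l) (at_left t))"

end

theory Submission
  imports Defs
begin

text \<open>The operator \<open>L = \<epsilon> D\<close> integrates differences against the bounded kernel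
\<open>\<epsilon> A\<^sub>U\<^sub>V |x - y|\<^sup>\<alpha>\<close>: the singularity on the diagonal is invisible, because \<open>A\<^sub>U\<^sub>U = 0\<close> and
different members of the covering are disjoint clopen sets. The kernel is therefore continuous and
bounded on \<open>Z \<times> Z\<close>, and \<open>L\<close> is a bounded operator on \<open>C(Z)\<close>. Such an operator generates a pure jump
process of bounded rate. Concretely \<open>L = c (P - 1)\<close>, where \<open>P f(x) = E f(J x e)\<close> is the Markov operator
of a random map: the random mark \<open>e = (v, w)\<close> proposes the target \<open>v\<close>, distributed according to the
Haar measure on \<open>Z\<close>, and \<open>w\<close>, uniform on \<open>[0, 1]\<close>, decides whether the proposal is accepted or the
process stays where it is (\<open>ex_feller_jump_process\<close>).

The process is built from a random stream of pairs (waiting time, mark), with exponential waiting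
times of rate \<open>c\<close>: its state at time \<open>t\<close> is obtained from the starting point by applying the marks of
all jumps up to \<open>t\<close>. Its paths are step functions with finitely many jumps in bounded time, so they
have the required regularity. The probability \<open>p\<^sub>t(x, \<cdot>)\<close> is the law of the state at time \<open>t\<close>.

The Markov property is reduced to one statement about the stream of clocks. Run the stream \<open>\<omega>\<close> up to
time \<open>s\<close>, then discard the rest and go on with an independent copy \<open>\<omega>'\<close>. The spliced stream has the
same law as \<open>\<omega>\<close>, because exponential variables have no memory (\<open>distr_splice_at\<close>). Almost surely its
path agrees with that of \<open>\<omega>\<close> up to time \<open>s\<close> and from then on is the path of \<open>\<omega>'\<close> started at the state of
\<open>\<omega>\<close> at time \<open>s\<close> (\<open>state_splice_past\<close>, \<open>state_splice_future\<close>). Fubini's theorem then gives the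
Markov property with respect to the natural filtration on the space of paths, and the
Chapman-Kolmogorov equations.

For the Cauchy problem, a solution exists because the exponential series of the bounded operator \<open>L\<close>
converges (\<open>cauchy_solution_exp_series\<close>). Every solution \<open>h\<close> satisfies, by variation of constants,
\<open>h(t, x) = E (if t < \<tau> then h\<^sub>0(x) else h(t - \<tau>, J x e))\<close>, where \<open>\<tau>\<close> is the first waiting
time and \<open>e\<close> the first mark. Conditioning on the first jump shows that \<open>E h\<^sub>0(X\<^sub>t)\<close> satisfies the
same equation. On \<open>[0, T]\<close> the difference of the two is contracted by the factor \<open>1 - exp(- c T) < 1\<close>,
the probability of a jump before time \<open>T\<close>, hence they agree (\<open>cauchy_solution_eq_expected\<close>). This
identifies the solution with the integral against \<open>p\<^sub>t(x, \<cdot>)\<close> and proves uniqueness at the same time.\<close>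

section \<open>Paths driven by a stream of waiting times and marks\<close>

primrec jump_time :: "(real \<times> 'e) stream \<Rightarrow> nat \<Rightarrow> real" where
  "jump_time \<omega> 0 = 0"
| "jump_time \<omega> (Suc n) = fst (shd \<omega>) + jump_time (stl \<omega>) n"

declare jump_time.simps(2) [simp del]

lemma jump_time_Cons [simp]: "jump_time (m ## \<omega>) (Suc n) = fst m + jump_time \<omega> n"
  by (simp add: jump_time.simps)

primrec embedded_chain :: "('x \<Rightarrow> 'e \<Rightarrow> 'x) \<Rightarrow> 'x \<Rightarrow> (real \<times> 'e) stream \<Rightarrow> nat \<Rightarrow> 'x" where
  "embedded_chain J x \<omega> 0 = x"
| "embedded_chain J x \<omega> (Suc n) = embedded_chain J (J x (snd (shd \<omega>))) (stl \<omega>) n"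

text \<open>The streams without explosion: waiting times are positive and jumps do not accumulate in finite
time. Almost every stream of exponential waiting times is of this kind.\<close>

definition regular :: "(real \<times> 'e) stream \<Rightarrow> bool" where
  "regular \<omega> \<longleftrightarrow> (\<forall>n. 0 < fst (\<omega> !! n)) \<and> (\<forall>t. \<exists>n. t < jump_time \<omega> n)"

definition jump_count :: "real \<Rightarrow> (real \<times> 'e) stream \<Rightarrow> nat" where
  "jump_count t \<omega> = (LEAST n. t < jump_time \<omega> (Suc n))"

text \<open>Irregular streams leave the state at its starting point, so that every stream defines a path of step
function type.\<close>

definition state :: "('x \<Rightarrow> 'e \<Rightarrow> 'x) \<Rightarrow> 'x \<Rightarrow> real \<Rightarrow> (real \<times> 'e) stream \<Rightarrow> 'x" where
  "state J x t \<omega> = (if regular \<omega> then embedded_chain J x \<omega> (jump_count t \<omega>) else x)"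

lemma jump_time_Suc_snth: "jump_time \<omega> (Suc n) = jump_time \<omega> n + fst (\<omega> !! n)"
  by (induction n arbitrary: \<omega>) (auto simp: jump_time.simps)

lemma regular_Cons: "regular (m ## \<omega>) \<longleftrightarrow> 0 < fst m \<and> regular \<omega>"
proof -
  have "(\<forall>n. 0 < fst ((m ## \<omega>) !! n)) \<longleftrightarrow> 0 < fst m \<and> (\<forall>n. 0 < fst (\<omega> !! n))"
    by (metis not0_implies_Suc snth.simps stream.sel)
  moreover have "(\<forall>t. \<exists>n. t < jump_time (m ## \<omega>) n) \<longleftrightarrow> (\<forall>t. \<exists>n. t < jump_time \<omega> n)" if "0 < fst m"
  proof safe
    fix t assume "\<forall>t. \<exists>n. t < jump_time (m ## \<omega>) n"
    then obtain n where n: "t + fst m < jump_time (m ## \<omega>) n" by blast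
    show "\<exists>n. t < jump_time \<omega> n"
    proof (cases n)
      case 0
      then show ?thesis using n that by (intro exI[of _ 0]) simp
    next
      case (Suc k)
      then show ?thesis using n by (intro exI[of _ k]) simp
    qed
  next
    fix t assume "\<forall>t. \<exists>n. t < jump_time \<omega> n"
    then obtain n where "t - fst m < jump_time \<omega> n" by blast
    then show "\<exists>n. t < jump_time (m ## \<omega>) n" by (intro exI[of _ "Suc n"]) simp
  qed
  ultimately show ?thesis unfolding regular_def by blast
qed

lemma regular_ex_jump_time: "regular \<omega> \<Longrightarrow> 0 \<le> t \<Longrightarrow> \<exists>n. t < jump_time \<omega> (Suc n)"
  unfolding regular_def by (metis jump_time.simps(1) not_le old.nat.exhaust)

lemma jump_count_0: "t < fst (shd \<omega>) \<Longrightarrow> jump_count t \<omega> = 0"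
  unfolding jump_count_def by (rule Least_eq_0) (simp add: jump_time.simps)

lemma state_before_first_jump: "regular \<omega> \<Longrightarrow> t < fst (shd \<omega>) \<Longrightarrow> state J x t \<omega> = x"
  by (simp add: state_def jump_count_0)

lemma state_after_first_jump:
  assumes "regular (m ## \<omega>)" "fst m \<le> t"
  shows "state J x t (m ## \<omega>) = state J (J x (snd m)) (t - fst m) \<omega>"
proof -
  have "0 \<le> t" using assms by (auto simp: regular_Cons)
  then obtain n where n: "t < jump_time (m ## \<omega>) (Suc n)"
    using regular_ex_jump_time[OF assms(1)] by blast
  have "jump_count t (m ## \<omega>) = Suc (jump_count (t - fst m) \<omega>)"
    unfolding jump_count_def
    by (subst Least_Suc[of "\<lambda>n. t < jump_time (m ## \<omega>) (Suc n)", OF n])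
       (use assms in \<open>auto simp: algebra_simps\<close>)
  then show ?thesis using assms by (simp add: state_def regular_Cons)
qed

lemma state_at_0: "state J x 0 \<omega> = x"
  by (cases "regular \<omega>") (auto simp: state_def regular_def jump_count_0 dest: spec[of _ 0])

text \<open>Follow \<open>\<omega>\<close> up to time \<open>s\<close> and then restart with \<open>\<omega>'\<close>. The waiting time of \<open>\<omega>\<close> which is
running at time \<open>s\<close> is replaced: its elapsed part is kept and prolonged by the first waiting time of
\<open>\<omega>'\<close>. The first argument counts down the time left until \<open>s\<close>; if \<open>s\<close> is never reached, the
result is \<open>\<omega>\<close>.\<close>

primcorec splice_at :: "real \<Rightarrow> (real \<times> 'e) stream \<Rightarrow> (real \<times> 'e) stream \<Rightarrow> (real \<times> 'e) stream" where
  "splice_at s \<omega> \<omega>' = (if s < fst (shd \<omega>) then (s + fst (shd \<omega>'), snd (shd \<omega>')) else shd \<omega>)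
     ## (if s < fst (shd \<omega>) then stl \<omega>' else splice_at (s - fst (shd \<omega>)) (stl \<omega>) \<omega>')"

lemma splice_before: "s < fst m \<Longrightarrow> splice_at s (m ## \<omega>) (m' ## \<omega>') = (s + fst m', snd m') ## \<omega>'"
  by (subst splice_at.code) simp

lemma splice_after: "\<not> s < fst m \<Longrightarrow> splice_at s (m ## \<omega>) \<omega>' = m ## splice_at (s - fst m) \<omega> \<omega>'"
  by (subst splice_at.code) simp

text \<open>Induction on a number of jumps after which time \<open>s\<close> has certainly passed. If \<open>s\<close> lies before the first
jump of \<open>\<omega>\<close>, the spliced stream is \<open>\<omega>'\<close> with its first waiting time prolonged by \<open>s\<close>; otherwise the first
jump is common to both streams and the claim passes to the tails.\<close>

lemma regular_and_state_splice_at: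
  assumes "regular \<omega>'"
  shows "s < jump_time \<omega> n \<Longrightarrow> 0 \<le> s \<Longrightarrow> regular \<omega> \<Longrightarrow>
    regular (splice_at s \<omega> \<omega>') \<and>
    (\<forall>u\<in>{0..s}. state J x u (splice_at s \<omega> \<omega>') = state J x u \<omega>) \<and>
    (\<forall>t\<ge>0. state J x (s + t) (splice_at s \<omega> \<omega>') = state J (state J x s \<omega>) t \<omega>')"
proof (induction n arbitrary: s \<omega> x)
  case 0
  then show ?case by simp
next
  case (Suc n)
  obtain m \<omega>1 where \<omega>: "\<omega> = m ## \<omega>1" by (cases \<omega>)
  obtain m' \<omega>1' where \<omega>': "\<omega>' = m' ## \<omega>1'" by (cases \<omega>')
  have pos: "0 < fst m" "0 < fst m'" and reg: "regular \<omega>1" "regular \<omega>1'"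
    using Suc.prems assms by (simp_all add: \<omega> \<omega>' regular_Cons)
  show ?case
  proof (cases "s < fst m")
    case True
    have sp: "splice_at s \<omega> \<omega>' = (s + fst m', snd m') ## \<omega>1'"
      using True by (simp add: \<omega> \<omega>' splice_before)
    have r: "regular ((s + fst m', snd m') ## \<omega>1')"
      using Suc.prems pos reg by (simp add: regular_Cons)
    have s: "state J x u \<omega> = x" if "u \<le> s" for u
      using that True Suc.prems(3) by (intro state_before_first_jump) (auto simp: \<omega>)
    have "state J x (s + t) ((s + fst m', snd m') ## \<omega>1') = state J x t \<omega>'" for t
    proof (cases "t < fst m'")
      case True
      then show ?thesis
        using r assms by (simp add: \<omega>' state_before_first_jump)
    next
      case False
      then show ?thesis
        using r assms by (simp add: \<omega>' state_after_first_jump)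
    qed
    moreover have "state J x u ((s + fst m', snd m') ## \<omega>1') = x" if "u \<le> s" for u
      using that pos by (intro state_before_first_jump r) auto
    ultimately show ?thesis
      using r s by (simp add: sp)
  next
    case False
    define s1 where "s1 = s - fst m"
    have s1: "s = fst m + s1" "s1 < jump_time \<omega>1 n" "0 \<le> s1"
      using False Suc.prems(1) by (auto simp: s1_def \<omega>)
    note IH = Suc.IH[OF s1(2,3) reg(1)]
    have sp: "splice_at s \<omega> \<omega>' = m ## splice_at s1 \<omega>1 \<omega>'"
      using False by (simp add: \<omega> s1_def splice_after)
    have r: "regular (m ## splice_at s1 \<omega>1 \<omega>')"
      using IH pos by (simp add: regular_Cons)
    note IH' = conjunct1[OF IH] conjunct1[OF conjunct2[OF IH]] conjunct2[OF conjunct2[OF IH]]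
    have "state J x u (m ## splice_at s1 \<omega>1 \<omega>') = state J x u \<omega>" if "u \<in> {0..s}" for u
    proof (cases "u < fst m")
      case True
      then show ?thesis using r Suc.prems(3) by (simp add: \<omega> state_before_first_jump)
    next
      case False
      then have "u - fst m \<in> {0..s1}" using that by (simp add: s1_def)
      then show ?thesis using False r Suc.prems(3) IH by (simp add: \<omega> state_after_first_jump)
    qed
    moreover have "state J x (s + t) (m ## splice_at s1 \<omega>1 \<omega>') = state J (state J x s \<omega>) t \<omega>'"
      if "0 \<le> t" for t
    proof -
      have eq: "s + t - fst m = s1 + t" by (simp add: s1_def)
      show ?thesis
        using that r Suc.prems(3) IH'(3) False
        by (simp add: \<omega> state_after_first_jump eq s1_def[symmetric])
    qed
    ultimately show ?thesis
      using r by (simp add: sp)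
  qed
qed

lemma
  assumes "regular \<omega>" "regular \<omega>'" "0 \<le> s"
  shows state_splice_past: "0 \<le> u \<Longrightarrow> u \<le> s \<Longrightarrow> state J x u (splice_at s \<omega> \<omega>') = state J x u \<omega>"
    and state_splice_future:
      "0 \<le> t \<Longrightarrow> state J x (s + t) (splice_at s \<omega> \<omega>') = state J (state J x s \<omega>) t \<omega>'"
proof -
  obtain n where n: "s < jump_time \<omega> (Suc n)"
    using regular_ex_jump_time[OF assms(1,3)] by blast
  note * = regular_and_state_splice_at[OF assms(2) n assms(3,1), of J x]
  show "0 \<le> u \<Longrightarrow> u \<le> s \<Longrightarrow> state J x u (splice_at s \<omega> \<omega>') = state J x u \<omega>"
    using * by auto
  show "0 \<le> t \<Longrightarrow> state J x (s + t) (splice_at s \<omega> \<omega>') = state J (state J x s \<omega>) t \<omega>'"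
    using * by auto
qed

lemma jump_time_mono: "regular \<omega> \<Longrightarrow> m \<le> n \<Longrightarrow> jump_time \<omega> m \<le> jump_time \<omega> n"
  by (rule lift_Suc_mono_le[of "jump_time \<omega>"])
     (auto simp: jump_time_Suc_snth regular_def less_imp_le)

lemma state_between_jumps:
  assumes "regular \<omega>" "jump_time \<omega> n \<le> t" "t < jump_time \<omega> (Suc n)"
  shows "state J x t \<omega> = embedded_chain J x \<omega> n"
proof -
  have "jump_count t \<omega> = n"
    unfolding jump_count_def
  proof (rule Least_equality)
    show "t < jump_time \<omega> (Suc n)" by fact
    show "n \<le> k" if "t < jump_time \<omega> (Suc k)" for k
      using jump_time_mono[OF assms(1), of "Suc k" n] that assms(2) by (force simp: not_less_eq_eq)
  qed
  then show ?thesis using assms(1) by (simp add: state_def)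
qed

text \<open>Between consecutive jump times the path is constant, and it is right continuous since the state at a
jump time is the one after the jump. For left limits the interval has to be chosen half-open on the
other side.\<close>

lemma cadlag_path_state:
  assumes Z: "\<And>n. embedded_chain J x \<omega> n \<in> Z"
  shows "cadlag_path Z (\<lambda>t. state J x t \<omega>)"
proof (cases "regular \<omega>")
  case False
  then show ?thesis
    using Z[of 0] by (auto simp: cadlag_path_def state_def)
next
  case True
  have right: "((\<lambda>t. state J x t \<omega>) \<longlongrightarrow> state J x t \<omega>) (at_right t)" if "0 \<le> t" for t
  proof -
    define n where "n = jump_count t \<omega>"
    have less: "t < jump_time \<omega> (Suc n)"
      unfolding n_def jump_count_def by (rule LeastI_ex) (rule regular_ex_jump_time[OF True that])
    have le: "jump_time \<omega> n \<le> t"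
    proof (cases n)
      case 0
      then show ?thesis using that by simp
    next
      case (Suc k)
      then have "\<not> t < jump_time \<omega> (Suc k)"
        unfolding n_def jump_count_def by (intro not_less_Least) simp
      then show ?thesis using Suc by simp
    qed
    have "\<forall>\<^sub>F u in at_right t. u < jump_time \<omega> (Suc n)"
      using less by (rule order_tendstoD(2)[OF tendsto_ident_at])
    then have "\<forall>\<^sub>F u in at_right t. state J x u \<omega> = state J x t \<omega>"
      using eventually_at_right_less[of t]
    proof eventually_elim
      case (elim u)
      then show ?case
        using state_between_jumps[OF True, of n u J x] state_between_jumps[OF True le less, of J x] le by simp
    qed
    then show ?thesis by (rule tendsto_eventually)
  qed
  have left: "\<exists>l\<in>Z. ((\<lambda>t. state J x t \<omega>) \<longlongrightarrow> l) (at_left t)" if "0 < t" for t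
  proof -
    \<comment> \<open>A jump at time \<open>t\<close> itself does not influence the left limit: hence \<open>\<le>\<close> instead of \<open><\<close>.\<close>
    define n where "n = (LEAST n. t \<le> jump_time \<omega> (Suc n))"
    have "\<exists>n. t \<le> jump_time \<omega> (Suc n)"
      using regular_ex_jump_time[OF True, of t] that by (auto intro: less_imp_le)
    then have ge: "t \<le> jump_time \<omega> (Suc n)"
      unfolding n_def by (rule LeastI_ex)
    have less: "jump_time \<omega> n < t"
    proof (cases n)
      case 0
      then show ?thesis using that by simp
    next
      case (Suc k)
      then have "\<not> t \<le> jump_time \<omega> (Suc k)"
        unfolding n_def by (intro not_less_Least) simp
      then show ?thesis using Suc by simp
    qed
    have "\<forall>\<^sub>F u in at_left t. jump_time \<omega> n < u"
      using less by (rule order_tendstoD(1)[OF tendsto_ident_at])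
    moreover have "\<forall>\<^sub>F u in at_left t. u < t"
      by (simp add: eventually_at_filter)
    ultimately have "\<forall>\<^sub>F u in at_left t. state J x u \<omega> = embedded_chain J x \<omega> n"
    proof eventually_elim
      case (elim u)
      then show ?case
        using state_between_jumps[OF True, of n u J x] ge by simp
    qed
    then show ?thesis using Z[of n] by (intro bexI[of _ "embedded_chain J x \<omega> n"] tendsto_eventually)
  qed
  have "state J x t \<omega> \<in> Z" for t
    using Z by (simp add: state_def True)
  with right left show ?thesis by (auto simp: cadlag_path_def)
qed

section \<open>Measurability of the construction\<close>

text \<open>The class of functions is chosen closed under taking tails: once the restart has happened, the tail of
the spliced stream is a tail of \<open>h\<close> instead of another splice.\<close>

lemma measurable_splice_at [measurable]:
  fixes M :: "'e measure"
  assumes [measurable]: "f \<in> borel_measurable N" "g \<in> N \<rightarrow>\<^sub>M stream_space (borel \<Otimes>\<^sub>M M)" "h \<in> N \<rightarrow>\<^sub>M stream_space (borel \<Otimes>\<^sub>M M)"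
  shows "(\<lambda>x. splice_at (f x) (g x) (h x)) \<in> N \<rightarrow>\<^sub>M stream_space (borel \<Otimes>\<^sub>M M)"
proof -
  define F where "F = (\<lambda>k :: 'a \<Rightarrow> (real \<times> 'e) stream. \<exists>p. Measurable.pred N p \<and>
     (\<exists>f g h. f \<in> borel_measurable N \<and> g \<in> N \<rightarrow>\<^sub>M stream_space (borel \<Otimes>\<^sub>M M) \<and> h \<in> N \<rightarrow>\<^sub>M stream_space (borel \<Otimes>\<^sub>M M) \<and>
       k = (\<lambda>x. if p x then h x else splice_at (f x) (g x) (h x))))"
  have "F (\<lambda>x. splice_at (f x) (g x) (h x))"
    unfolding F_def by (intro exI[of _ "\<lambda>_. False"] conjI exI[of _ f] exI[of _ g] exI[of _ h]) simp_all
  then show ?thesis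
  proof (rule measurable_stream_coinduct[where F=F])
    fix k assume "F k"
    then obtain p f g h where [measurable]: "Measurable.pred N p" "f \<in> borel_measurable N"
        "g \<in> N \<rightarrow>\<^sub>M stream_space (borel \<Otimes>\<^sub>M M)" "h \<in> N \<rightarrow>\<^sub>M stream_space (borel \<Otimes>\<^sub>M M)"
      and k: "k = (\<lambda>x. if p x then h x else splice_at (f x) (g x) (h x))"
      unfolding F_def by blast
    have "(\<lambda>x. shd (k x)) = (\<lambda>x. if p x then shd (h x) else
        if f x < fst (shd (g x)) then (f x + fst (shd (h x)), snd (shd (h x))) else shd (g x))"
      by (auto simp: k)
    also have "\<dots> \<in> N \<rightarrow>\<^sub>M borel \<Otimes>\<^sub>M M" by measurable
    finally show "(\<lambda>x. shd (k x)) \<in> N \<rightarrow>\<^sub>M borel \<Otimes>\<^sub>M M" .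
  next
    fix k assume "F k"
    then obtain p f g h where [measurable]: "Measurable.pred N p" "f \<in> borel_measurable N"
        "g \<in> N \<rightarrow>\<^sub>M stream_space (borel \<Otimes>\<^sub>M M)" "h \<in> N \<rightarrow>\<^sub>M stream_space (borel \<Otimes>\<^sub>M M)"
      and k: "k = (\<lambda>x. if p x then h x else splice_at (f x) (g x) (h x))"
      unfolding F_def by blast
    let ?p = "\<lambda>x. p x \<or> f x < fst (shd (g x))"
    let ?f = "\<lambda>x. f x - fst (shd (g x))" and ?g = "\<lambda>x. stl (g x)"
    let ?h = "\<lambda>x. if ?p x then stl (h x) else h x"
    have "(\<lambda>x. stl (k x)) = (\<lambda>x. if ?p x then ?h x else splice_at (?f x) (?g x) (?h x))"
      by (auto simp: k)
    moreover have "Measurable.pred N ?p" "?f \<in> borel_measurable N"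
        "?g \<in> N \<rightarrow>\<^sub>M stream_space (borel \<Otimes>\<^sub>M M)" "?h \<in> N \<rightarrow>\<^sub>M stream_space (borel \<Otimes>\<^sub>M M)"
      by measurable
    ultimately show "F (\<lambda>x. stl (k x))" unfolding F_def by blast
  qed
qed

lemma measurable_embedded_chain [measurable]:
  assumes J: "(\<lambda>(x, e). J x e) \<in> S \<Otimes>\<^sub>M E \<rightarrow>\<^sub>M S"
  shows "f \<in> N \<rightarrow>\<^sub>M S \<Longrightarrow> g \<in> N \<rightarrow>\<^sub>M stream_space (borel \<Otimes>\<^sub>M E) \<Longrightarrow> (\<lambda>x. embedded_chain J (f x) (g x) n) \<in> N \<rightarrow>\<^sub>M S"
proof (induction n arbitrary: f g)
  case (Suc n)
  note [measurable] = Suc.prems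
  have "(\<lambda>x. J (f x) (snd (shd (g x)))) \<in> N \<rightarrow>\<^sub>M S"
    using measurable_compose[OF measurable_Pair[of f N S "\<lambda>x. snd (shd (g x))" E] J] by simp
  then show ?case using Suc.IH by simp
qed simp

lemma measurable_jump_time [measurable]:
  "g \<in> N \<rightarrow>\<^sub>M stream_space (borel \<Otimes>\<^sub>M E) \<Longrightarrow> (\<lambda>x. jump_time (g x) n) \<in> borel_measurable N"
proof (induction n arbitrary: g)
  case (Suc n)
  note [measurable] = Suc.prems Suc.IH
  show ?case unfolding jump_time.simps by measurable
qed simp

text \<open>Countably many times suffice, which makes regularity a measurable condition.\<close>

lemma regular_countable:
  "regular \<omega> \<longleftrightarrow> (\<forall>n. 0 < fst (\<omega> !! n)) \<and> (\<forall>k::nat. \<exists>n. real k < jump_time \<omega> n)"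
  unfolding regular_def by (metis reals_Archimedean2 order_less_trans)

lemma measurable_regular [measurable]:
  assumes [measurable]: "g \<in> N \<rightarrow>\<^sub>M stream_space (borel \<Otimes>\<^sub>M E)"
  shows "Measurable.pred N (\<lambda>x. regular (g x))"
  unfolding regular_countable by measurable

lemma measurable_state:
  assumes J [measurable]: "(\<lambda>(x, e). J x e) \<in> S \<Otimes>\<^sub>M E \<rightarrow>\<^sub>M S"
    and [measurable]: "r \<in> borel_measurable N" "f \<in> N \<rightarrow>\<^sub>M S" "g \<in> N \<rightarrow>\<^sub>M stream_space (borel \<Otimes>\<^sub>M E)"
  shows "(\<lambda>x. state J (f x) (r x) (g x)) \<in> N \<rightarrow>\<^sub>M S"
proof -
  have [measurable]: "(\<lambda>x. jump_count (r x) (g x)) \<in> N \<rightarrow>\<^sub>M count_space UNIV"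
    unfolding jump_count_def by measurable
  have "(\<lambda>x. embedded_chain J (f x) (g x) (jump_count (r x) (g x))) \<in> N \<rightarrow>\<^sub>M S"
    by (rule measurable_compose_countable) (auto intro!: measurable_embedded_chain)
  then show ?thesis unfolding state_def by measurable
qed

lemma embedded_chain_in_space:
  assumes "(\<lambda>(x, e). J x e) \<in> S \<Otimes>\<^sub>M E \<rightarrow>\<^sub>M S"
  shows "x \<in> space S \<Longrightarrow> \<omega> \<in> space (stream_space (borel \<Otimes>\<^sub>M E)) \<Longrightarrow> embedded_chain J x \<omega> n \<in> space S"
  using measurable_space[OF measurable_embedded_chain[OF assms, of "\<lambda>_. x" "return (stream_space (borel \<Otimes>\<^sub>M E)) \<omega>" "\<lambda>x. x" n]]
  by simp

section \<open>Exponential clocks and their lack of memory\<close>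

text \<open>Absence of memory in integrated form: the density satisfies \<open>f(s + t) = f(t) exp(- l s)\<close>.\<close>

lemma nn_integral_exponential_shift:
  assumes [measurable]: "g \<in> borel_measurable borel" and "0 < l" "0 \<le> s"
  shows "(\<integral>\<^sup>+t. g (s + t) \<partial>density lborel (exponential_density l)) * ennreal (exp (- l * s)) =
    (\<integral>\<^sup>+t. g t * indicator {s..} t \<partial>density lborel (exponential_density l))"
proof -
  let ?f = "\<lambda>t. ennreal (exponential_density l t) * (g t * indicator {s..} t)"
  have [measurable]: "exponential_density l \<in> borel_measurable borel" by simp
  have "(\<integral>\<^sup>+t. g t * indicator {s..} t \<partial>density lborel (exponential_density l)) = (\<integral>\<^sup>+t. ?f t \<partial>lborel)"
    by (subst nn_integral_density) auto
  also have "\<dots> = (\<integral>\<^sup>+t. ?f (s + 1 * t) \<partial>lborel)"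
    by (subst nn_integral_real_affine[where c=1 and t=s]) auto
  also have "\<dots> = (\<integral>\<^sup>+t. ennreal (exponential_density l t) * g (s + t) * ennreal (exp (- l * s)) \<partial>lborel)"
  proof (intro nn_integral_cong)
    fix t :: real
    have "exponential_density l (s + t) = exponential_density l t * exp (- l * s)" if "0 \<le> t"
      using that assms(3) by (simp add: exponential_density_def exp_add[symmetric] algebra_simps)
    then have "ennreal (exponential_density l (s + t)) = ennreal (exponential_density l t) * ennreal (exp (- l * s))"
      if "0 \<le> t"
      using that by (simp add: ennreal_mult'')
    then show "?f (s + 1 * t) = ennreal (exponential_density l t) * g (s + t) * ennreal (exp (- l * s))"
      using assms(3) by (cases "0 \<le> t") (simp_all add: exponential_density_def mult_ac)
  qed
  also have "\<dots> = (\<integral>\<^sup>+t. ennreal (exponential_density l t) * g (s + t) \<partial>lborel) * ennreal (exp (- l * s))"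
    by (rule nn_integral_multc) simp
  also have "(\<integral>\<^sup>+t. ennreal (exponential_density l t) * g (s + t) \<partial>lborel) =
      (\<integral>\<^sup>+t. g (s + t) \<partial>density lborel (exponential_density l))"
    by (subst nn_integral_density) auto
  finally show ?thesis by simp
qed

text \<open>The data of a jump process: jumps occur at rate \<open>c\<close>, and each applies the map \<open>J\<close> with an
independent mark of law \<open>E\<close>. Driving the jumps by marks, instead of by a transition kernel, makes all
paths, from every starting point, functions of the same stream.\<close>

locale jump_process = prob_space E for E :: "'e measure" +
  fixes S :: "'x measure" and J :: "'x \<Rightarrow> 'e \<Rightarrow> 'x" and c :: real
  assumes rate_pos: "0 < c"
    and J [measurable]: "(\<lambda>(x, e). J x e) \<in> S \<Otimes>\<^sub>M E \<rightarrow>\<^sub>M S"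
begin

definition Exp :: "real measure" where
  "Exp = density lborel (exponential_density c)"

definition Clocks :: "(real \<times> 'e) stream measure" where
  "Clocks = stream_space (Exp \<Otimes>\<^sub>M E)"

lemma sets_Exp [simp, measurable_cong]: "sets Exp = sets borel"
  by (simp add: Exp_def)

lemma space_Exp [simp]: "space Exp = UNIV"
  by (simp add: Exp_def)

sublocale Exp: prob_space Exp
  unfolding Exp_def by (rule prob_space_exponential_density[OF rate_pos])

sublocale mark: pair_prob_space Exp E ..

lemma sets_Clocks [measurable_cong]: "sets Clocks = sets (stream_space (borel \<Otimes>\<^sub>M E))"
  unfolding Clocks_def by (intro sets_stream_space_cong sets_pair_measure_cong) simp_all

sublocale Clocks: prob_space Clocks
  unfolding Clocks_def by (rule mark.prob_space_stream_space)

lemma space_Clocks: "space Clocks = streams (UNIV \<times> space E)"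
  by (simp add: Clocks_def space_stream_space space_pair_measure)

lemma nn_integral_Clocks:
  assumes [measurable]: "f \<in> borel_measurable Clocks"
  shows "(\<integral>\<^sup>+\<omega>. f \<omega> \<partial>Clocks) = (\<integral>\<^sup>+m. \<integral>\<^sup>+\<omega>. f (m ## \<omega>) \<partial>Clocks \<partial>(Exp \<Otimes>\<^sub>M E))"
  using assms unfolding Clocks_def by (rule mark.nn_integral_stream_space)

lemma AE_Exp_neq: "AE t in Exp. t \<noteq> s"
  unfolding Exp_def using AE_lborel_singleton[of s] by (subst AE_density) auto

lemma nn_integral_Exp_shift:
  assumes "g \<in> borel_measurable borel" "0 \<le> s"
  shows "(\<integral>\<^sup>+t. g (s + t) \<partial>Exp) * ennreal (exp (- c * s)) = (\<integral>\<^sup>+t. g t * indicator {s<..} t \<partial>Exp)"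
proof -
  have "(\<integral>\<^sup>+t. g (s + t) \<partial>Exp) * ennreal (exp (- c * s)) = (\<integral>\<^sup>+t. g t * indicator {s..} t \<partial>Exp)"
    using nn_integral_exponential_shift[OF assms(1) rate_pos assms(2)] by (simp add: Exp_def)
  also have "\<dots> = (\<integral>\<^sup>+t. g t * indicator {s<..} t \<partial>Exp)"
    by (rule nn_integral_cong_AE) (use AE_Exp_neq[of s] in \<open>auto elim!: eventually_mono simp: indicator_def\<close>)
  finally show ?thesis .
qed

lemma AE_Exp_pos: "AE t in Exp. 0 < t"
  unfolding Exp_def using AE_lborel_singleton[of 0]
  by (subst AE_density) (auto simp: exponential_density_def elim!: eventually_mono)

lemma emeasure_Exp_greaterThan: "0 \<le> s \<Longrightarrow> emeasure Exp {s<..} = ennreal (exp (- c * s))"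
  using nn_integral_Exp_shift[of "\<lambda>_. 1" s] Exp.emeasure_space_1 by simp

end

context jump_process begin

lemma nn_integral_exp_Exp: "(\<integral>\<^sup>+t. ennreal (exp (- t)) \<partial>Exp) = ennreal (c / (c + 1))"
proof -
  have "(\<integral>\<^sup>+t. ennreal (exp (- t)) \<partial>Exp) = (\<integral>\<^sup>+t. ennreal (exponential_density c t) * ennreal (exp (- t)) \<partial>lborel)"
    unfolding Exp_def by (rule nn_integral_density) auto
  also have "\<dots> = (\<integral>\<^sup>+t. ennreal (c / (c + 1)) * ennreal (exponential_density (c + 1) t) \<partial>lborel)"
  proof (intro nn_integral_cong)
    fix t :: real
    have "exponential_density c t * exp (- t) = c / (c + 1) * exponential_density (c + 1) t"
      using rate_pos by (simp add: exponential_density_def exp_add[symmetric] field_simps)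
    then show "ennreal (exponential_density c t) * ennreal (exp (- t)) =
        ennreal (c / (c + 1)) * ennreal (exponential_density (c + 1) t)"
      using rate_pos by (simp add: ennreal_mult[symmetric] exponential_density_nonneg)
  qed
  also have "\<dots> = ennreal (c / (c + 1)) * (\<integral>\<^sup>+t. ennreal (exponential_density (c + 1) t) * 1 \<partial>lborel)"
    by (simp add: nn_integral_cmult)
  also have "(\<integral>\<^sup>+t. ennreal (exponential_density (c + 1) t) * 1 \<partial>lborel) = (\<integral>\<^sup>+t. 1 \<partial>density lborel (exponential_density (c + 1)))"
    by (rule nn_integral_density[symmetric]) auto
  also have "\<dots> = 1"
    using prob_space.emeasure_space_1[OF prob_space_exponential_density[of "c + 1"]] rate_pos by simp
  finally show ?thesis by simp
qed

text \<open>The \<open>n\<close>-th jump time is a sum of independent waiting times, so its Laplace transform at \<open>1\<close> is the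
\<open>n\<close>-th power of the one of a single waiting time.\<close>

lemma nn_integral_exp_jump_time:
  "(\<integral>\<^sup>+\<omega>. ennreal (exp (- jump_time \<omega> n)) \<partial>Clocks) = ennreal ((c / (c + 1)) ^ n)"
proof (induction n)
  case 0
  then show ?case using Clocks.emeasure_space_1 by simp
next
  case (Suc n)
  have "(\<integral>\<^sup>+\<omega>. ennreal (exp (- jump_time \<omega> (Suc n))) \<partial>Clocks)
      = (\<integral>\<^sup>+m. \<integral>\<^sup>+\<omega>. ennreal (exp (- fst m)) * ennreal (exp (- jump_time \<omega> n)) \<partial>Clocks \<partial>(Exp \<Otimes>\<^sub>M E))"
    by (subst nn_integral_Clocks) (simp_all add: ennreal_mult[symmetric] exp_add[symmetric])
  also have "\<dots> = (\<integral>\<^sup>+m. ennreal (exp (- fst m)) * ennreal ((c / (c + 1)) ^ n) \<partial>(Exp \<Otimes>\<^sub>M E))"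
    by (subst nn_integral_cmult) (simp_all add: Suc)
  also have "\<dots> = (\<integral>\<^sup>+m. ennreal (exp (- fst m)) \<partial>(Exp \<Otimes>\<^sub>M E)) * ennreal ((c / (c + 1)) ^ n)"
    by (rule nn_integral_multc) simp
  also have "(\<integral>\<^sup>+m. ennreal (exp (- fst m)) \<partial>(Exp \<Otimes>\<^sub>M E)) = (\<integral>\<^sup>+t. ennreal (exp (- t)) \<partial>Exp)"
    by (subst nn_integral_fst[symmetric]) (simp_all add: emeasure_space_1)
  finally show ?case
    using rate_pos by (simp add: nn_integral_exp_Exp ennreal_mult[symmetric])
qed

text \<open>Explosion has probability zero: the Laplace transform of the limit of the jump times is at most
\<open>(c / (c + 1))\<^sup>n\<close> for every \<open>n\<close>, hence zero.\<close>

lemma AE_regular: "AE \<omega> in Clocks. regular \<omega>"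
proof -
  let ?f = "\<lambda>\<omega>. INF n. ennreal (exp (- jump_time \<omega> n))"
  have "(\<integral>\<^sup>+\<omega>. ?f \<omega> \<partial>Clocks) \<le> ennreal ((c / (c + 1)) ^ n)" for n
    unfolding nn_integral_exp_jump_time[symmetric] by (intro nn_integral_mono INF_lower) simp
  moreover have "(\<lambda>n. ennreal ((c / (c + 1)) ^ n)) \<longlonglongrightarrow> 0"
    using tendsto_ennrealI[OF LIMSEQ_power_zero[of "c / (c + 1)"]] rate_pos by simp
  ultimately have "(\<integral>\<^sup>+\<omega>. ?f \<omega> \<partial>Clocks) \<le> 0"
    by (intro LIMSEQ_le_const) auto
  then have "AE \<omega> in Clocks. ?f \<omega> = 0"
    by (subst (asm) le_zero_eq, subst (asm) nn_integral_0_iff_AE) auto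
  moreover have "AE \<omega> in Clocks. stream_all (\<lambda>m. 0 < fst m) \<omega>"
    unfolding Clocks_def
  proof (rule mark.AE_stream_all)
    show "AE m in Exp \<Otimes>\<^sub>M E. 0 < fst m"
    proof (rule AE_distrD[of fst "Exp \<Otimes>\<^sub>M E" Exp "\<lambda>t. 0 < t"])
      show "AE t in distr (Exp \<Otimes>\<^sub>M E) Exp fst. 0 < t"
        unfolding distr_pair_fst by (rule AE_Exp_pos)
    qed simp
  qed measurable
  ultimately show ?thesis
  proof eventually_elim
    case (elim \<omega>)
    have "\<exists>n. t < jump_time \<omega> n" for t
    proof (rule ccontr)
      assume "\<not> (\<exists>n. t < jump_time \<omega> n)"
      then have "ennreal (exp (- t)) \<le> ?f \<omega>"
        by (intro INF_greatest) (auto simp: not_less)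
      then show False using elim(1) by simp
    qed
    then show ?case using elim(2) by (auto simp: regular_def stream_all_def)
  qed
qed

text \<open>A waiting time longer than \<open>s\<close> may be replaced by \<open>s\<close> plus a fresh waiting time, together with a fresh
mark.\<close>

lemma nn_integral_mark_shift:
  assumes [measurable]: "H \<in> borel_measurable (Exp \<Otimes>\<^sub>M E)" and s: "0 \<le> s"
  shows "(\<integral>\<^sup>+m. indicator {s<..} (fst m) * (\<integral>\<^sup>+m'. H (s + fst m', snd m') \<partial>(Exp \<Otimes>\<^sub>M E)) \<partial>(Exp \<Otimes>\<^sub>M E)) =
    (\<integral>\<^sup>+m. indicator {s<..} (fst m) * H m \<partial>(Exp \<Otimes>\<^sub>M E))"
proof -
  define W where "W = (\<integral>\<^sup>+m'. H (s + fst m', snd m') \<partial>(Exp \<Otimes>\<^sub>M E))"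
  have [measurable]: "H \<in> borel_measurable (borel \<Otimes>\<^sub>M E)"
    using assms(1) by (simp cong: measurable_cong_sets)
  have "(\<integral>\<^sup>+m. indicator {s<..} (fst m) * W \<partial>(Exp \<Otimes>\<^sub>M E)) = (\<integral>\<^sup>+m. indicator {s<..} (fst m) \<partial>(Exp \<Otimes>\<^sub>M E)) * W"
    by (rule nn_integral_multc) measurable
  also have "(\<integral>\<^sup>+m. indicator {s<..} (fst m) \<partial>(Exp \<Otimes>\<^sub>M E)) = emeasure Exp {s<..}"
    by (subst nn_integral_fst[symmetric]) (simp_all add: emeasure_space_1)
  also have "\<dots> * W = (\<integral>\<^sup>+t. \<integral>\<^sup>+e. H (s + t, e) \<partial>E \<partial>Exp) * ennreal (exp (- c * s))"
    unfolding W_def using s by (subst nn_integral_fst[symmetric]) (simp_all add: emeasure_Exp_greaterThan mult.commute)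
  also have "\<dots> = (\<integral>\<^sup>+t. (\<integral>\<^sup>+e. H (t, e) \<partial>E) * indicator {s<..} t \<partial>Exp)"
    by (rule nn_integral_Exp_shift) (use s in measurable)
  also have "\<dots> = (\<integral>\<^sup>+t. \<integral>\<^sup>+e. indicator {s<..} t * H (t, e) \<partial>E \<partial>Exp)"
    by (intro nn_integral_cong, subst nn_integral_cmult) (simp_all add: mult.commute)
  also have "\<dots> = (\<integral>\<^sup>+m. indicator {s<..} (fst m) * H m \<partial>(Exp \<Otimes>\<^sub>M E))"
    by (subst nn_integral_fst[symmetric]) simp_all
  finally show ?thesis by (simp add: W_def)
qed

text \<open>Induction over the length of the cylinder, splitting at the first waiting time of \<open>\<omega>\<close>. When it exceeds
\<open>s\<close>, the first entry of the spliced stream is a prolonged entry of \<open>\<omega>'\<close>, and lack of memory turns the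
prolongation back into an ordinary entry conditioned to be longer than \<open>s\<close>; when it does not, the
induction hypothesis applies to the tails and the remaining time.\<close>

lemma nn_integral_splice_scylinder:
  assumes "\<And>A. A \<in> set As \<Longrightarrow> A \<in> sets (borel \<Otimes>\<^sub>M E)" "0 \<le> s"
  defines "C \<equiv> \<lambda>As. scylinder (UNIV \<times> space E) As"
  shows "(\<integral>\<^sup>+\<omega>. \<integral>\<^sup>+\<omega>'. indicator (C As) (splice_at s \<omega> \<omega>') \<partial>Clocks \<partial>Clocks) = emeasure Clocks (C As)"
  using assms(1,2)
proof (induction As arbitrary: s)
  case Nil
  have "splice_at s \<omega> \<omega>' \<in> C []" if "\<omega> \<in> space Clocks" "\<omega>' \<in> space Clocks" for \<omega> \<omega>'
  proof -
    have "(\<lambda>(\<omega>, \<omega>'). splice_at s \<omega> \<omega>') \<in> Clocks \<Otimes>\<^sub>M Clocks \<rightarrow>\<^sub>M Clocks"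
      by measurable
    from measurable_space[OF this, of "(\<omega>, \<omega>')"] that show ?thesis
      by (simp add: C_def space_pair_measure space_Clocks)
  qed
  then have "(\<integral>\<^sup>+\<omega>. \<integral>\<^sup>+\<omega>'. indicator (C []) (splice_at s \<omega> \<omega>') \<partial>Clocks \<partial>Clocks) = (\<integral>\<^sup>+\<omega>. \<integral>\<^sup>+\<omega>'. 1 \<partial>Clocks \<partial>Clocks)"
    by (intro nn_integral_cong) simp
  also have "\<dots> = emeasure Clocks (C [])"
    using Clocks.emeasure_space_1 by (simp add: C_def space_Clocks[symmetric])
  finally show ?case .
next
  case (Cons A As)
  have C_sets: "C Bs \<in> sets Clocks" if "\<And>A. A \<in> set Bs \<Longrightarrow> A \<in> sets (borel \<Otimes>\<^sub>M E)" for Bs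
    using sets_scylinder[of Bs "borel \<Otimes>\<^sub>M E"] that
    by (simp add: C_def sets_Clocks space_pair_measure)
  have [measurable]: "A \<in> sets (borel \<Otimes>\<^sub>M E)" "C As \<in> sets Clocks" "C (A # As) \<in> sets Clocks"
    using Cons.prems C_sets by auto
  let ?D = "Exp \<Otimes>\<^sub>M E"
  let ?\<gamma> = "emeasure Clocks (C As)"
  have ind: "indicator (C (A # As)) (m ## \<omega>) = indicator A m * (indicator (C As) \<omega> :: ennreal)"
    if "m \<in> space ?D" "\<omega> \<in> space Clocks" for m \<omega>
    using that by (auto simp: C_def indicator_def space_pair_measure space_Clocks)
  have sp: "splice_at s \<omega> \<omega>' \<in> space Clocks" if "\<omega> \<in> space Clocks" "\<omega>' \<in> space Clocks" for s \<omega> \<omega>'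
    using measurable_space[of "\<lambda>(\<omega>, \<omega>'). splice_at s \<omega> \<omega>'" "Clocks \<Otimes>\<^sub>M Clocks" Clocks "(\<omega>, \<omega>')"] that
    by (simp add: space_pair_measure)
  have before: "(\<integral>\<^sup>+\<omega>'. indicator (C (A # As)) (splice_at s (m ## \<omega>) \<omega>') \<partial>Clocks) =
      (\<integral>\<^sup>+m'. indicator A (s + fst m', snd m') * ?\<gamma> \<partial>?D)" if "s < fst m" "m \<in> space ?D" "\<omega> \<in> space Clocks" for m \<omega>
  proof -
    have "m ## \<omega> \<in> space Clocks"
      using that by (simp add: space_Clocks streams_Stream space_pair_measure mem_Times_iff)
    from measurable_compose[OF measurable_Pair1'[OF this, of Clocks],
        of "\<lambda>(\<omega>, \<omega>'). splice_at s \<omega> \<omega>'" Clocks]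
    have [measurable]: "(\<lambda>\<omega>'. splice_at s (m ## \<omega>) \<omega>') \<in> Clocks \<rightarrow>\<^sub>M Clocks"
      by simp
    have "(\<integral>\<^sup>+\<omega>'. indicator (C (A # As)) (splice_at s (m ## \<omega>) \<omega>') \<partial>Clocks) =
      (\<integral>\<^sup>+m'. \<integral>\<^sup>+\<omega>'. indicator (C (A # As)) ((s + fst m', snd m') ## \<omega>') \<partial>Clocks \<partial>?D)"
      using that by (subst nn_integral_Clocks) (auto simp: splice_before)
    also have "\<dots> = (\<integral>\<^sup>+m'. \<integral>\<^sup>+\<omega>'. indicator A (s + fst m', snd m') * indicator (C As) \<omega>' \<partial>Clocks \<partial>?D)"
      by (intro nn_integral_cong ind) (auto simp: space_pair_measure)
    also have "\<dots> = (\<integral>\<^sup>+m'. indicator A (s + fst m', snd m') * ?\<gamma> \<partial>?D)"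
      by (intro nn_integral_cong) (simp add: nn_integral_cmult)
    finally show ?thesis .
  qed
  have after: "(\<integral>\<^sup>+\<omega>. \<integral>\<^sup>+\<omega>'. indicator (C (A # As)) (splice_at s (m ## \<omega>) \<omega>') \<partial>Clocks \<partial>Clocks) =
      indicator A m * ?\<gamma>" if "\<not> s < fst m" "m \<in> space ?D" for m
  proof -
    have "(\<integral>\<^sup>+\<omega>. \<integral>\<^sup>+\<omega>'. indicator (C (A # As)) (splice_at s (m ## \<omega>) \<omega>') \<partial>Clocks \<partial>Clocks) =
      (\<integral>\<^sup>+\<omega>. \<integral>\<^sup>+\<omega>'. indicator A m * indicator (C As) (splice_at (s - fst m) \<omega> \<omega>') \<partial>Clocks \<partial>Clocks)"
      using that by (intro nn_integral_cong) (simp add: splice_after ind sp)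
    also have "\<dots> = indicator A m * (\<integral>\<^sup>+\<omega>. \<integral>\<^sup>+\<omega>'. indicator (C As) (splice_at (s - fst m) \<omega> \<omega>') \<partial>Clocks \<partial>Clocks)"
      by (cases "m \<in> A") simp_all
    also have "\<dots> = indicator A m * ?\<gamma>"
      using that Cons.prems by (subst Cons.IH) auto
    finally show ?thesis .
  qed
  define W where "W = (\<integral>\<^sup>+m'. indicator A (s + fst m', snd m') * ?\<gamma> \<partial>?D)"
  have "(\<integral>\<^sup>+\<omega>. \<integral>\<^sup>+\<omega>'. indicator (C (A # As)) (splice_at s \<omega> \<omega>') \<partial>Clocks \<partial>Clocks) =
      (\<integral>\<^sup>+m. \<integral>\<^sup>+\<omega>. \<integral>\<^sup>+\<omega>'. indicator (C (A # As)) (splice_at s (m ## \<omega>) \<omega>') \<partial>Clocks \<partial>Clocks \<partial>?D)"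
    by (subst nn_integral_Clocks) simp_all
  also have "\<dots> = (\<integral>\<^sup>+m. indicator {s<..} (fst m) * W + indicator {..s} (fst m) * (indicator A m * ?\<gamma>) \<partial>?D)"
  proof (intro nn_integral_cong)
    fix m assume m: "m \<in> space ?D"
    show "(\<integral>\<^sup>+\<omega>. \<integral>\<^sup>+\<omega>'. indicator (C (A # As)) (splice_at s (m ## \<omega>) \<omega>') \<partial>Clocks \<partial>Clocks) =
      indicator {s<..} (fst m) * W + indicator {..s} (fst m) * (indicator A m * ?\<gamma>)"
    proof (cases "s < fst m")
      case True
      have "(\<integral>\<^sup>+\<omega>. \<integral>\<^sup>+\<omega>'. indicator (C (A # As)) (splice_at s (m ## \<omega>) \<omega>') \<partial>Clocks \<partial>Clocks) = (\<integral>\<^sup>+\<omega>. W \<partial>Clocks)"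
        unfolding W_def by (intro nn_integral_cong before True m)
      then show ?thesis using True by (simp add: Clocks.emeasure_space_1)
    next
      case False
      then show ?thesis using m by (subst after) auto
    qed
  qed
  also have "\<dots> = (\<integral>\<^sup>+m. indicator {s<..} (fst m) * W \<partial>?D) + (\<integral>\<^sup>+m. indicator {..s} (fst m) * (indicator A m * ?\<gamma>) \<partial>?D)"
    by (rule nn_integral_add) measurable
  also have "(\<integral>\<^sup>+m. indicator {s<..} (fst m) * W \<partial>?D) = (\<integral>\<^sup>+m. indicator {s<..} (fst m) * (indicator A m * ?\<gamma>) \<partial>?D)"
    unfolding W_def by (rule nn_integral_mark_shift) (use Cons.prems in measurable)
  also have "\<dots> + (\<integral>\<^sup>+m. indicator {..s} (fst m) * (indicator A m * ?\<gamma>) \<partial>?D) = (\<integral>\<^sup>+m. indicator A m * ?\<gamma> \<partial>?D)"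
    by (subst nn_integral_add[symmetric]) (auto intro!: nn_integral_cong simp: indicator_def)
  also have "\<dots> = (\<integral>\<^sup>+m. \<integral>\<^sup>+\<omega>. indicator (C (A # As)) (m ## \<omega>) \<partial>Clocks \<partial>?D)"
    by (intro nn_integral_cong) (simp add: ind nn_integral_cmult cong: nn_integral_cong)
  also have "\<dots> = (\<integral>\<^sup>+\<omega>. indicator (C (A # As)) \<omega> \<partial>Clocks)"
    by (rule nn_integral_Clocks[symmetric]) measurable
  finally show ?case by simp
qed

text \<open>Restarting the clocks at a fixed time does not change their law, since both laws agree on cylinders.\<close>

lemma distr_splice_at:
  assumes "0 \<le> s"
  shows "distr (Clocks \<Otimes>\<^sub>M Clocks) Clocks (\<lambda>(\<omega>, \<omega>'). splice_at s \<omega> \<omega>') = Clocks"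
    (is "distr _ _ ?f = _")
proof (rule stream_space_eq_scylinder[where S="borel \<Otimes>\<^sub>M E" and G="sets (borel \<Otimes>\<^sub>M E)" and C="{UNIV \<times> space E}"])
  interpret CC: pair_prob_space Clocks Clocks ..
  have f[measurable]: "?f \<in> Clocks \<Otimes>\<^sub>M Clocks \<rightarrow>\<^sub>M Clocks"
    by measurable
  show "prob_space (distr (Clocks \<Otimes>\<^sub>M Clocks) Clocks ?f)"
    by (rule CC.prob_space_distr) measurable
  show "prob_space Clocks" by (rule Clocks.prob_space_axioms)
  show "Int_stable (sets (borel \<Otimes>\<^sub>M E))" by (rule sets.Int_stable)
  show "sets (borel \<Otimes>\<^sub>M E) = sets (sigma (space (borel \<Otimes>\<^sub>M E)) (sets (borel \<Otimes>\<^sub>M E)))"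
    by (simp add: sets.space_closed sets.sigma_sets_eq)
  show "{UNIV \<times> space E} \<subseteq> sets (borel \<Otimes>\<^sub>M E)" "\<Union>{UNIV \<times> space E} = space (borel \<Otimes>\<^sub>M E)"
    by (auto simp: space_pair_measure)
  show "sets (borel \<Otimes>\<^sub>M E) \<subseteq> Pow (space (borel \<Otimes>\<^sub>M E))" by (rule sets.space_closed)
  show "sets (distr (Clocks \<Otimes>\<^sub>M Clocks) Clocks ?f) = sets (stream_space (borel \<Otimes>\<^sub>M E))"
      "sets Clocks = sets (stream_space (borel \<Otimes>\<^sub>M E))"
    by (simp_all add: sets_Clocks)
  fix As assume "As \<in> lists (sets ((borel :: real measure) \<Otimes>\<^sub>M E))"
  then have As: "\<And>A. A \<in> set As \<Longrightarrow> A \<in> sets (borel \<Otimes>\<^sub>M E)" by auto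
  let ?C = "scylinder (space (borel \<Otimes>\<^sub>M E)) As"
  have C[measurable]: "?C \<in> sets Clocks"
    using sets_scylinder[of As "borel \<Otimes>\<^sub>M E"] As by (simp add: sets_Clocks)
  have "emeasure (distr (Clocks \<Otimes>\<^sub>M Clocks) Clocks ?f) ?C = (\<integral>\<^sup>+x. indicator ?C x \<partial>distr (Clocks \<Otimes>\<^sub>M Clocks) Clocks ?f)"
    by simp
  also have "\<dots> = (\<integral>\<^sup>+x. indicator ?C (?f x) \<partial>(Clocks \<Otimes>\<^sub>M Clocks))"
    by (rule nn_integral_distr) measurable
  also have "\<dots> = (\<integral>\<^sup>+\<omega>. \<integral>\<^sup>+\<omega>'. indicator ?C (splice_at s \<omega> \<omega>') \<partial>Clocks \<partial>Clocks)"
    by (subst Clocks.nn_integral_fst[symmetric]) simp_all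
  also have "\<dots> = emeasure Clocks ?C"
    using nn_integral_splice_scylinder[OF As assms] by (simp add: space_pair_measure)
  finally show "emeasure (distr (Clocks \<Otimes>\<^sub>M Clocks) Clocks ?f) ?C = emeasure Clocks ?C" .
qed simp

end

section \<open>The Markov property on the space of paths\<close>

text \<open>The sigma-algebra generated by the coordinates with index in \<open>T\<close>. It is defined on an arbitrary set
\<open>\<Omega>\<close> of functions, and its space is \<open>\<Omega>\<close> even for empty \<open>T\<close>; the sigma-algebras at negative
times are therefore trivial ones on the same set.\<close>

definition coordinate_algebra :: "('t \<Rightarrow> 'x) set \<Rightarrow> 'x measure \<Rightarrow> 't set \<Rightarrow> ('t \<Rightarrow> 'x) measure" where
  "coordinate_algebra \<Omega> S T = sigma \<Omega> {(\<lambda>\<gamma>. \<gamma> t) -` B \<inter> \<Omega> | t B. t \<in> T \<and> B \<in> sets S}"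

lemma space_coordinate_algebra [simp]: "space (coordinate_algebra \<Omega> S T) = \<Omega>"
  by (auto simp: coordinate_algebra_def intro!: space_measure_of)

lemma sets_coordinate_algebra:
  "sets (coordinate_algebra \<Omega> S T) = sigma_sets \<Omega> {(\<lambda>\<gamma>. \<gamma> t) -` B \<inter> \<Omega> | t B. t \<in> T \<and> B \<in> sets S}"
  unfolding coordinate_algebra_def by (intro sets_measure_of) auto

lemma coordinate_algebra_mono: "T \<subseteq> T' \<Longrightarrow> sets (coordinate_algebra \<Omega> S T) \<subseteq> sets (coordinate_algebra \<Omega> S T')"
  unfolding sets_coordinate_algebra by (intro sigma_sets_mono') blast

lemma measurable_coordinate:
  "t \<in> T \<Longrightarrow> (\<And>\<gamma>. \<gamma> \<in> \<Omega> \<Longrightarrow> \<gamma> t \<in> space S) \<Longrightarrow> (\<lambda>\<gamma>. \<gamma> t) \<in> coordinate_algebra \<Omega> S T \<rightarrow>\<^sub>M S"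
  by (rule measurableI) (auto simp: sets_coordinate_algebra intro!: sigma_sets.Basic)

lemma measurable_coordinate_algebra:
  assumes "\<And>x. x \<in> space N \<Longrightarrow> f x \<in> \<Omega>" "\<And>t. t \<in> T \<Longrightarrow> (\<lambda>x. f x t) \<in> N \<rightarrow>\<^sub>M S"
  shows "f \<in> N \<rightarrow>\<^sub>M coordinate_algebra \<Omega> S T"
  unfolding coordinate_algebra_def
proof (rule measurable_sigma_sets[OF sets_measure_of])
  fix A assume "A \<in> {(\<lambda>\<gamma>. \<gamma> t) -` B \<inter> \<Omega> | t B. t \<in> T \<and> B \<in> sets S}"
  then obtain t B where A: "A = (\<lambda>\<gamma>. \<gamma> t) -` B \<inter> \<Omega>" and "t \<in> T" "B \<in> sets S" by auto
  then have "(\<lambda>x. f x t) -` B \<inter> space N \<in> sets N"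
    using assms(2) by (auto intro: measurable_sets)
  also have "(\<lambda>x. f x t) -` B \<inter> space N = f -` A \<inter> space N"
    using assms(1) by (auto simp: A)
  finally show "f -` A \<inter> space N \<in> sets N" .
qed (use assms(1) in auto)

text \<open>This is how the past enters the Markov property: an event of the past cannot distinguish a path
from its splice.\<close>

lemma coordinate_algebra_determined:
  assumes "A \<in> sets (coordinate_algebra \<Omega> S T)" "\<gamma> \<in> \<Omega>" "\<gamma>' \<in> \<Omega>" "\<And>t. t \<in> T \<Longrightarrow> \<gamma> t = \<gamma>' t"
  shows "\<gamma> \<in> A \<longleftrightarrow> \<gamma>' \<in> A"
  using assms(1) unfolding sets_coordinate_algebra
  by (induction rule: sigma_sets.induct) (use assms in auto)

context jump_process begin

definition transition :: "real \<Rightarrow> 'x \<Rightarrow> 'x measure" where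
  "transition t x = distr Clocks S (state J x t)"

lemma measurable_state_process [measurable]:
  "r \<in> borel_measurable N \<Longrightarrow> f \<in> N \<rightarrow>\<^sub>M S \<Longrightarrow> g \<in> N \<rightarrow>\<^sub>M Clocks \<Longrightarrow> (\<lambda>x. state J (f x) (r x) (g x)) \<in> N \<rightarrow>\<^sub>M S"
  using measurable_state[OF J, of r N f g] by (simp cong: measurable_cong_sets add: sets_Clocks)

lemma measurable_state_Clocks: "x \<in> space S \<Longrightarrow> state J x t \<in> Clocks \<rightarrow>\<^sub>M S"
  using measurable_state_process[of "\<lambda>_. t" Clocks "\<lambda>_. x" "\<lambda>\<omega>. \<omega>"] by simp

lemma measurable_transition [measurable]: "transition t \<in> S \<rightarrow>\<^sub>M prob_algebra S"
  unfolding transition_def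
proof (rule measurable_distr_prob_space2)
  show "(\<lambda>x. Clocks) \<in> S \<rightarrow>\<^sub>M prob_algebra Clocks"
    by (auto simp: space_prob_algebra Clocks.prob_space_axioms)
qed measurable

lemma sets_transition [simp]: "sets (transition t x) = sets S"
  by (simp add: transition_def)

lemma prob_space_transition: "x \<in> space S \<Longrightarrow> prob_space (transition t x)"
  unfolding transition_def by (intro Clocks.prob_space_distr measurable_state_Clocks)

lemma emeasure_transition:
  assumes "x \<in> space S" and [measurable]: "B \<in> sets S"
  shows "emeasure (transition t x) B = (\<integral>\<^sup>+\<omega>. indicator B (state J x t \<omega>) \<partial>Clocks)"
proof -
  have [measurable]: "state J x t \<in> Clocks \<rightarrow>\<^sub>M S" by (rule measurable_state_Clocks[OF assms(1)])
  have "emeasure (transition t x) B = (\<integral>\<^sup>+y. indicator B y \<partial>transition t x)"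
    by simp
  also have "\<dots> = (\<integral>\<^sup>+\<omega>. indicator B (state J x t \<omega>) \<partial>Clocks)"
    unfolding transition_def by (rule nn_integral_distr) measurable
  finally show ?thesis .
qed

text \<open>Replace the stream by a spliced one, which has the same law. The factor \<open>\<Phi>\<close> depends on the path up
to time \<open>s\<close> only and does not see the splice; the state at time \<open>s + t\<close> is that of an independent
process started at the state at time \<open>s\<close>. Integrating over the second stream first gives the
transition probability.\<close>

lemma nn_integral_Markov:
  assumes x [measurable]: "x \<in> space S" and [measurable]: "B \<in> sets S" and s: "0 \<le> s" and t: "0 \<le> t"
    and \<Phi>[measurable]: "\<Phi> \<in> borel_measurable Clocks"
    and past: "\<And>\<omega> \<omega>'. \<omega> \<in> space Clocks \<Longrightarrow> \<omega>' \<in> space Clocks \<Longrightarrow>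
      (\<And>u. u \<in> {0..s} \<Longrightarrow> state J x u \<omega> = state J x u \<omega>') \<Longrightarrow> \<Phi> \<omega> = \<Phi> \<omega>'"
  shows "(\<integral>\<^sup>+\<omega>. \<Phi> \<omega> * indicator B (state J x (s + t) \<omega>) \<partial>Clocks) =
    (\<integral>\<^sup>+\<omega>. \<Phi> \<omega> * emeasure (transition t (state J x s \<omega>)) B \<partial>Clocks)"
proof -
  let ?f = "\<lambda>(\<omega>, \<omega>'). splice_at s \<omega> \<omega>'"
  have [measurable]: "state J x u \<in> Clocks \<rightarrow>\<^sub>M S" for u
    by (rule measurable_state_Clocks) fact
  have sp: "splice_at s \<omega> \<omega>' \<in> space Clocks" if "\<omega> \<in> space Clocks" "\<omega>' \<in> space Clocks" for \<omega> \<omega>'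
    using measurable_space[of ?f "Clocks \<Otimes>\<^sub>M Clocks" Clocks "(\<omega>, \<omega>')"] that
    by (simp add: space_pair_measure)
  have "(\<integral>\<^sup>+\<omega>. \<Phi> \<omega> * indicator B (state J x (s + t) \<omega>) \<partial>Clocks) =
      (\<integral>\<^sup>+\<omega>. \<Phi> \<omega> * indicator B (state J x (s + t) \<omega>) \<partial>distr (Clocks \<Otimes>\<^sub>M Clocks) Clocks ?f)"
    by (simp only: distr_splice_at[OF s])
  also have "\<dots> = (\<integral>\<^sup>+p. \<Phi> (?f p) * indicator B (state J x (s + t) (?f p)) \<partial>(Clocks \<Otimes>\<^sub>M Clocks))"
    by (rule nn_integral_distr) measurable
  also have "\<dots> = (\<integral>\<^sup>+\<omega>. \<integral>\<^sup>+\<omega>'. \<Phi> (splice_at s \<omega> \<omega>') * indicator B (state J x (s + t) (splice_at s \<omega> \<omega>')) \<partial>Clocks \<partial>Clocks)"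
    by (subst Clocks.nn_integral_fst[symmetric]) simp_all
  also have "\<dots> = (\<integral>\<^sup>+\<omega>. \<integral>\<^sup>+\<omega>'. \<Phi> \<omega> * indicator B (state J (state J x s \<omega>) t \<omega>') \<partial>Clocks \<partial>Clocks)"
  proof (rule nn_integral_cong_AE)
    show "AE \<omega> in Clocks. (\<integral>\<^sup>+\<omega>'. \<Phi> (splice_at s \<omega> \<omega>') * indicator B (state J x (s + t) (splice_at s \<omega> \<omega>')) \<partial>Clocks) =
      (\<integral>\<^sup>+\<omega>'. \<Phi> \<omega> * indicator B (state J (state J x s \<omega>) t \<omega>') \<partial>Clocks)"
      using AE_regular AE_space
    proof eventually_elim
      case \<omega>: (elim \<omega>)
      show ?case
      proof (rule nn_integral_cong_AE, use AE_regular AE_space in eventually_elim)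
        case \<omega>': (elim \<omega>')
        have "\<Phi> (splice_at s \<omega> \<omega>') = \<Phi> \<omega>"
          using \<omega> \<omega>' s by (intro past sp state_splice_past) auto
        then show ?case
          using \<omega> \<omega>' s t by (simp add: state_splice_future)
      qed
    qed
  qed
  also have "\<dots> = (\<integral>\<^sup>+\<omega>. \<Phi> \<omega> * emeasure (transition t (state J x s \<omega>)) B \<partial>Clocks)"
  proof (intro nn_integral_cong)
    fix \<omega> assume "\<omega> \<in> space Clocks"
    then have y: "state J x s \<omega> \<in> space S"
      by (rule measurable_space[of "state J x s" Clocks S, rotated]) measurable
    then have [measurable]: "state J (state J x s \<omega>) t \<in> Clocks \<rightarrow>\<^sub>M S"
      by (rule measurable_state_Clocks)
    show "(\<integral>\<^sup>+\<omega>'. \<Phi> \<omega> * indicator B (state J (state J x s \<omega>) t \<omega>') \<partial>Clocks) =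
        \<Phi> \<omega> * emeasure (transition t (state J x s \<omega>)) B"
      using y by (simp add: emeasure_transition nn_integral_cmult)
  qed
  finally show ?thesis .
qed

lemma nn_integral_transition:
  assumes "x \<in> space S" "f \<in> borel_measurable S"
  shows "(\<integral>\<^sup>+y. f y \<partial>transition t x) = (\<integral>\<^sup>+\<omega>. f (state J x t \<omega>) \<partial>Clocks)"
  unfolding transition_def using assms by (intro nn_integral_distr measurable_state_Clocks) auto

text \<open>The Chapman-Kolmogorov equation is the Markov property for the trivial event of the past.\<close>

theorem markov_transition_function_transition: "markov_transition_function S transition"
  unfolding markov_transition_function_def
proof (intro conjI allI impI ballI)
  fix t :: real
  show "transition t \<in> S \<rightarrow>\<^sub>M prob_algebra S" by measurable
next
  fix x assume x: "x \<in> space S"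
  show "transition 0 x = return S x"
  proof (rule measure_eqI)
    fix B assume "B \<in> sets (transition 0 x)"
    then show "emeasure (transition 0 x) B = emeasure (return S x) B"
      using x by (simp add: emeasure_transition state_at_0 Clocks.emeasure_space_1)
  qed simp
next
  fix s t :: real and x B assume *: "0 \<le> s" "0 \<le> t" "x \<in> space S" "B \<in> sets S"
  note [measurable] = *(4)
  have "emeasure (transition (s + t) x) B = (\<integral>\<^sup>+\<omega>. emeasure (transition t (state J x s \<omega>)) B \<partial>Clocks)"
    using nn_integral_Markov[of x B s t "\<lambda>_. 1"] * by (simp add: emeasure_transition)
  also have "\<dots> = (\<integral>\<^sup>+y. emeasure (transition t y) B \<partial>transition s x)"
    using * measurable_emeasure_kernel[OF measurable_prob_algebraD[OF measurable_transition]]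
    by (subst nn_integral_transition) simp_all
  finally show "emeasure (transition (s + t) x) B = (\<integral>\<^sup>+y. emeasure (transition t y) B \<partial>transition s x)" .
qed

text \<open>A conditional expectation is determined by its integrals over the events of the past. Pulled back to
the streams, these integrals are the ones of \<open>nn_integral_Markov\<close>, with \<open>\<Phi>\<close> the indicator of an event
of the past.\<close>

lemma real_cond_exp_Markov:
  fixes \<Omega> :: "(real \<Rightarrow> 'x) set"
  defines "M \<equiv> coordinate_algebra \<Omega> S {0..}" and "F \<equiv> \<lambda>t. coordinate_algebra \<Omega> S {0..t}"
    and "P \<equiv> \<lambda>x. distr Clocks (coordinate_algebra \<Omega> S {0..}) (\<lambda>\<omega> t. state J x t \<omega>)"
  assumes path: "\<And>x \<omega>. x \<in> space S \<Longrightarrow> \<omega> \<in> space Clocks \<Longrightarrow> (\<lambda>t. state J x t \<omega>) \<in> \<Omega>"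
    and coord: "\<And>\<gamma> t. \<gamma> \<in> \<Omega> \<Longrightarrow> 0 \<le> t \<Longrightarrow> \<gamma> t \<in> space S"
    and x: "x \<in> space S" and s: "0 \<le> s" and t: "0 \<le> t" and B: "B \<in> sets S"
  shows "AE \<gamma> in P x. real_cond_exp (P x) (F s) (indicator ((\<lambda>\<gamma>. \<gamma> (s + t)) -` B \<inter> space M)) \<gamma> =
    measure (transition t (\<gamma> s)) B"
proof -
  have path_meas [measurable]: "(\<lambda>\<omega> t. state J x t \<omega>) \<in> Clocks \<rightarrow>\<^sub>M M"
    unfolding M_def using x by (intro measurable_coordinate_algebra path measurable_state_Clocks) auto
  have Px: "P x = distr Clocks M (\<lambda>\<omega> t. state J x t \<omega>)"
    by (simp add: P_def M_def)
  interpret P: prob_space "P x"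
    unfolding Px by (rule Clocks.prob_space_distr) measurable
  have sub: "subalgebra (P x) (F s)"
    using s by (auto simp: subalgebra_def Px M_def F_def intro!: coordinate_algebra_mono)
  interpret finite_measure_subalgebra "P x" "F s"
    by unfold_locales (rule sub)
  have [measurable]: "(\<lambda>\<gamma>. \<gamma> (s + t)) \<in> M \<rightarrow>\<^sub>M S" "(\<lambda>\<gamma>. \<gamma> s) \<in> M \<rightarrow>\<^sub>M S"
    unfolding M_def using s t by (auto intro!: measurable_coordinate coord)
  have Fs [measurable]: "(\<lambda>\<gamma>. \<gamma> s) \<in> F s \<rightarrow>\<^sub>M S"
    unfolding F_def using s by (auto intro!: measurable_coordinate coord)
  have [measurable_cong]: "sets (P x) = sets M" by (simp add: Px)
  have space_P: "space (P x) = \<Omega>" by (simp add: Px M_def)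
  note [measurable] = B
  let ?f = "indicator ((\<lambda>\<gamma>. \<gamma> (s + t)) -` B \<inter> space M) :: (real \<Rightarrow> 'x) \<Rightarrow> real"
  let ?g = "\<lambda>\<gamma>. measure (transition t (\<gamma> s)) B"
  have [measurable]: "?f \<in> borel_measurable M" by measurable
  have gM[measurable]: "?g \<in> borel_measurable M" by measurable
  show ?thesis
  proof (rule real_cond_exp_charact)
    show "integrable (P x) ?f"
      by (rule P.integrable_const_bound[where B=1]) auto
    have g1: "?g \<gamma> \<le> 1" if "\<gamma> \<in> \<Omega>" for \<gamma>
      using that prob_space.prob_le_1[OF prob_space_transition[OF coord[OF that s]]] by blast
    then show "integrable (P x) ?g"
      by (intro P.integrable_const_bound[where B=1] AE_I2) (auto simp: space_P)
    show "?g \<in> borel_measurable (F s)" by measurable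
  next
    fix A assume A: "A \<in> sets (F s)"
    have AM [measurable]: "A \<in> sets M"
      using sub A by (auto simp: subalgebra_def Px)
    let ?path = "\<lambda>\<omega> t. state J x t \<omega>"
    have pathM: "?path \<omega> \<in> \<Omega>" if "\<omega> \<in> space Clocks" for \<omega>
      using path[OF x that] .
    have *: "(\<integral>\<^sup>+\<omega>. indicator A (?path \<omega>) * indicator B (state J x (s + t) \<omega>) \<partial>Clocks) =
        (\<integral>\<^sup>+\<omega>. indicator A (?path \<omega>) * emeasure (transition t (state J x s \<omega>)) B \<partial>Clocks)"
    proof (rule nn_integral_Markov[OF x B s t])
      show "(\<lambda>\<omega>. indicator A (?path \<omega>)) \<in> borel_measurable Clocks" by measurable
      fix \<omega> \<omega>' assume "\<omega> \<in> space Clocks" "\<omega>' \<in> space Clocks" "\<And>u. u \<in> {0..s} \<Longrightarrow> state J x u \<omega> = state J x u \<omega>'"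
      with coordinate_algebra_determined[OF A[unfolded F_def], of "?path \<omega>" "?path \<omega>'"] pathM
      show "indicator A (?path \<omega>) = (indicator A (?path \<omega>') :: ennreal)"
        by (simp add: indicator_def)
    qed
    have "(\<integral>\<^sup>+\<gamma>. ennreal (indicator A \<gamma> * ?f \<gamma>) \<partial>P x) =
        (\<integral>\<^sup>+\<omega>. indicator A (?path \<omega>) * indicator B (state J x (s + t) \<omega>) \<partial>Clocks)"
      unfolding Px
    proof (subst nn_integral_distr)
      show "(\<integral>\<^sup>+\<omega>. ennreal (indicator A (?path \<omega>) * ?f (?path \<omega>)) \<partial>Clocks) =
          (\<integral>\<^sup>+\<omega>. indicator A (?path \<omega>) * indicator B (state J x (s + t) \<omega>) \<partial>Clocks)"
        by (intro nn_integral_cong) (auto simp: indicator_def M_def pathM)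
    qed measurable
    also note *
    also have "(\<integral>\<^sup>+\<omega>. indicator A (?path \<omega>) * emeasure (transition t (state J x s \<omega>)) B \<partial>Clocks) =
        (\<integral>\<^sup>+\<gamma>. ennreal (indicator A \<gamma> * ?g \<gamma>) \<partial>P x)"
      unfolding Px
    proof (subst nn_integral_distr)
      show "(\<integral>\<^sup>+\<omega>. indicator A (?path \<omega>) * emeasure (transition t (state J x s \<omega>)) B \<partial>Clocks) =
          (\<integral>\<^sup>+\<omega>. ennreal (indicator A (?path \<omega>) * measure (transition t (state J x s \<omega>)) B) \<partial>Clocks)"
      proof (intro nn_integral_cong)
        fix \<omega> assume "\<omega> \<in> space Clocks"
        then have "state J x s \<omega> \<in> space S" using coord[OF pathM s] by simp
        then interpret T: prob_space "transition t (state J x s \<omega>)" by (rule prob_space_transition)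
        show "indicator A (?path \<omega>) * emeasure (transition t (state J x s \<omega>)) B =
            ennreal (indicator A (?path \<omega>) * measure (transition t (state J x s \<omega>)) B)"
          by (simp add: T.emeasure_eq_measure indicator_def)
      qed
    qed measurable
    finally have "(\<integral>\<^sup>+\<gamma>. ennreal (indicator A \<gamma> * ?f \<gamma>) \<partial>P x) = (\<integral>\<^sup>+\<gamma>. ennreal (indicator A \<gamma> * ?g \<gamma>) \<partial>P x)" .
    then show "(\<integral>\<gamma>\<in>A. ?f \<gamma> \<partial>P x) = (\<integral>\<gamma>\<in>A. ?g \<gamma> \<partial>P x)"
      unfolding set_lebesgue_integral_def
      by (subst (1 2) integral_eq_nn_integral) auto
  qed
qed

text \<open>The canonical process. The set \<open>\<Omega>\<close> of paths is left open so that it can carry the regularity of the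
paths; it only has to contain all paths of the construction. Singletons have to be measurable for the
starting point to be an event.\<close>

theorem markov_process_jump_process:
  fixes \<Omega> :: "(real \<Rightarrow> 'x) set"
  defines "M \<equiv> coordinate_algebra \<Omega> S {0..}"
  assumes path: "\<And>x \<omega>. x \<in> space S \<Longrightarrow> \<omega> \<in> space Clocks \<Longrightarrow> (\<lambda>t. state J x t \<omega>) \<in> \<Omega>"
    and coord: "\<And>\<gamma> t. \<gamma> \<in> \<Omega> \<Longrightarrow> 0 \<le> t \<Longrightarrow> \<gamma> t \<in> space S"
    and singleton: "\<And>x. x \<in> space S \<Longrightarrow> {x} \<in> sets S"
  shows "markov_process S transition M (\<lambda>t. coordinate_algebra \<Omega> S {0..t})
    (\<lambda>x. distr Clocks M (\<lambda>\<omega> t. state J x t \<omega>)) (\<lambda>t \<gamma>. \<gamma> t)"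
  unfolding markov_process_def
proof (intro conjI allI impI ballI)
  show "markov_transition_function S transition"
    by (rule markov_transition_function_transition)
  show "filtration (space M) (\<lambda>t. coordinate_algebra \<Omega> S {0..t})"
    by (rule filtration.intro) (auto simp: M_def intro!: coordinate_algebra_mono)
next
  fix t :: real assume "0 \<le> t"
  then show "subalgebra M (coordinate_algebra \<Omega> S {0..t})"
    by (auto simp: subalgebra_def M_def intro!: coordinate_algebra_mono)
  show "(\<lambda>\<gamma>. \<gamma> t) \<in> coordinate_algebra \<Omega> S {0..t} \<rightarrow>\<^sub>M S"
    using \<open>0 \<le> t\<close> by (auto intro!: measurable_coordinate coord)
next
  fix x assume x: "x \<in> space S"
  have path_meas [measurable]: "(\<lambda>\<omega> t. state J x t \<omega>) \<in> Clocks \<rightarrow>\<^sub>M M"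
    unfolding M_def using x by (intro measurable_coordinate_algebra path measurable_state_Clocks) auto
  let ?P = "distr Clocks M (\<lambda>\<omega> t. state J x t \<omega>)"
  show "prob_space ?P" by (rule Clocks.prob_space_distr) measurable
  show "sets ?P = sets M" by simp
  have coord_meas [measurable]: "(\<lambda>\<gamma>. \<gamma> t) \<in> M \<rightarrow>\<^sub>M S" if "0 \<le> t" for t
    unfolding M_def using that by (auto intro!: measurable_coordinate coord)
  have "distr ?P S (\<lambda>\<gamma>. \<gamma> t) = transition t x" if "0 \<le> t" for t
    unfolding transition_def using that
    by (subst distr_distr) (auto simp: comp_def intro!: coord_meas path_meas)
  then show "distr ?P S (\<lambda>\<gamma>. \<gamma> t) = transition t x" if "0 \<le> t" for t
    using that by simp
  show "AE \<gamma> in ?P. \<gamma> 0 = x"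
  proof (subst AE_distr_iff[OF path_meas])
    have "(\<lambda>\<gamma>. \<gamma> 0) -` {x} \<inter> space M \<in> sets M"
      using singleton[OF x] by (intro measurable_sets[OF coord_meas]) auto
    also have "(\<lambda>\<gamma>. \<gamma> 0) -` {x} \<inter> space M = {\<gamma> \<in> space M. \<gamma> 0 = x}"
      by auto
    finally show "{\<gamma> \<in> space M. \<gamma> 0 = x} \<in> sets M" .
    show "AE \<omega> in Clocks. state J x 0 \<omega> = x" by (simp add: state_at_0)
  qed
  show "AE \<gamma> in ?P. real_cond_exp ?P (coordinate_algebra \<Omega> S {0..s})
      (indicator ((\<lambda>\<gamma>. \<gamma> (s + t)) -` B \<inter> space M)) \<gamma> = measure (transition t (\<gamma> s)) B"
    if "0 \<le> s" "0 \<le> t" "B \<in> sets S" for s t B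
    unfolding M_def using real_cond_exp_Markov[of \<Omega> x s t B] path coord x that by blast
qed

end

section \<open>The semigroup as an exponential series\<close>

locale feller_jump_process =
  jump_process E "restrict_space borel Z" J c
  for E :: "'e measure" and Z :: "'x::topological_space set" and J :: "'x \<Rightarrow> 'e \<Rightarrow> 'x" and c :: real +
  assumes compact_Z: "compact Z"
    and feller: "\<And>f :: 'x \<Rightarrow> real. continuous_on Z f \<Longrightarrow> continuous_on Z (\<lambda>x. \<integral>e. f (J x e) \<partial>E)"
begin

definition generator :: "('x \<Rightarrow> real) \<Rightarrow> 'x \<Rightarrow> real" where
  "generator f x = c * ((\<integral>e. f (J x e) \<partial>E) - f x)"

lemma space_S [simp]: "space (restrict_space borel Z) = Z"
  by (simp add: space_restrict_space)

lemma J_in_Z: "x \<in> Z \<Longrightarrow> e \<in> space E \<Longrightarrow> J x e \<in> Z"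
  using measurable_space[OF J, of "(x, e)"] by (simp add: space_pair_measure)

lemma measurable_J: "x \<in> Z \<Longrightarrow> J x \<in> E \<rightarrow>\<^sub>M restrict_space borel Z"
  using measurable_compose[OF measurable_Pair1'[of x "restrict_space borel Z" E] J] by simp

lemma measurable_continuous_J:
  "x \<in> Z \<Longrightarrow> continuous_on Z f \<Longrightarrow> (\<lambda>e. f (J x e) :: real) \<in> borel_measurable E"
  by (rule measurable_compose[OF measurable_J borel_measurable_continuous_on_restrict])

lemma continuous_bounded:
  fixes f :: "'x \<Rightarrow> real"
  assumes "continuous_on Z f"
  obtains C where "0 \<le> C" "\<And>x. x \<in> Z \<Longrightarrow> \<bar>f x\<bar> \<le> C"
proof -
  have "bounded (f ` Z)"
    using compact_continuous_image[OF assms compact_Z] by (rule compact_imp_bounded)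
  then obtain C where "\<And>x. x \<in> Z \<Longrightarrow> \<bar>f x\<bar> \<le> C"
    by (auto simp: bounded_iff)
  then show ?thesis
    by (intro that[of "\<bar>C\<bar>"]) force+
qed

lemma integrable_J:
  assumes "x \<in> Z" "continuous_on Z f"
  shows "integrable E (\<lambda>e. f (J x e) :: real)"
proof -
  obtain C where "\<And>x. x \<in> Z \<Longrightarrow> \<bar>f x\<bar> \<le> C"
    using continuous_bounded[OF assms(2)] by blast
  then show ?thesis
    using assms by (intro integrable_const_bound[where B=C] AE_I2 measurable_continuous_J) (auto simp: J_in_Z)
qed

lemma abs_integral_le:
  assumes "\<And>e. e \<in> space E \<Longrightarrow> \<bar>f e :: real\<bar> \<le> C" "0 \<le> C"
  shows "\<bar>\<integral>e. f e \<partial>E\<bar> \<le> C"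
proof (cases "integrable E f")
  case True
  have "\<bar>\<integral>e. f e \<partial>E\<bar> \<le> (\<integral>e. \<bar>f e\<bar> \<partial>E)" using integral_norm_bound[of E f] by simp
  also have "\<dots> \<le> (\<integral>e. C \<partial>E)"
    using True assms by (intro integral_mono) auto
  also have "\<dots> = C" by (simp add: prob_space)
  finally show ?thesis .
qed (use assms(2) in \<open>simp add: not_integrable_integral_eq\<close>)

lemma abs_generator_le:
  assumes f: "\<And>x. x \<in> Z \<Longrightarrow> \<bar>f x\<bar> \<le> C" and "0 \<le> C" "x \<in> Z"
  shows "\<bar>generator f x\<bar> \<le> 2 * c * C"
proof -
  have "\<bar>\<integral>e. f (J x e) \<partial>E\<bar> \<le> C"
    using assms by (intro abs_integral_le f J_in_Z) auto
  then have "\<bar>(\<integral>e. f (J x e) \<partial>E) - f x\<bar> \<le> 2 * C"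
    using f[OF \<open>x \<in> Z\<close>] by linarith
  then have "c * \<bar>(\<integral>e. f (J x e) \<partial>E) - f x\<bar> \<le> c * (2 * C)"
    using rate_pos by (intro mult_left_mono) auto
  then show ?thesis
    using rate_pos by (simp add: generator_def abs_mult)
qed

lemma continuous_generator: "continuous_on Z f \<Longrightarrow> continuous_on Z (generator f)"
  unfolding generator_def by (intro continuous_intros feller)

lemma continuous_generator_pow: "continuous_on Z f \<Longrightarrow> continuous_on Z ((generator ^^ n) f)"
  by (induction n) (auto intro: continuous_generator)

lemma abs_generator_pow_le:
  assumes "\<And>x. x \<in> Z \<Longrightarrow> \<bar>f x\<bar> \<le> C" "0 \<le> C"
  shows "x \<in> Z \<Longrightarrow> \<bar>(generator ^^ n) f x\<bar> \<le> C * (2 * c) ^ n"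
proof (induction n arbitrary: x)
  case (Suc n)
  then show ?case
    using abs_generator_le[of "(generator ^^ n) f" "C * (2 * c) ^ n" x] assms(2) rate_pos
    by (simp add: mult_ac)
qed (use assms in simp)

text \<open>The exponential \<open>exp(t L) f\<close> of the generator, evaluated pointwise. Since \<open>L\<close> has norm at most \<open>2 c\<close>, the
series is dominated, uniformly in \<open>x\<close>, by the one of \<open>exp(2 c |t|)\<close>; convergence, continuity in \<open>x\<close> and
termwise differentiation in \<open>t\<close> follow from this bound and the theory of real power series.\<close>

definition exp_series :: "('x \<Rightarrow> real) \<Rightarrow> real \<Rightarrow> 'x \<Rightarrow> real" where
  "exp_series f t x = (\<Sum>n. (generator ^^ n) f x / fact n * t ^ n)"

lemma exp_series_term_le:
  assumes "\<And>x. x \<in> Z \<Longrightarrow> \<bar>f x\<bar> \<le> C" "0 \<le> C" "x \<in> Z"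
  shows "\<bar>(generator ^^ n) f x / fact n * t ^ n\<bar> \<le> C * ((2 * c * \<bar>t\<bar>) ^ n / fact n)"
proof -
  have "\<bar>(generator ^^ n) f x / fact n * t ^ n\<bar> = \<bar>(generator ^^ n) f x\<bar> * (\<bar>t\<bar> ^ n / fact n)"
    by (simp add: abs_mult power_abs)
  also have "\<dots> \<le> C * (2 * c) ^ n * (\<bar>t\<bar> ^ n / fact n)"
    using abs_generator_pow_le[OF assms] by (intro mult_right_mono) auto
  finally show ?thesis by (simp add: power_mult_distrib mult_ac)
qed

lemma summable_exp_bound: "summable (\<lambda>n. C * ((2 * c * \<bar>t\<bar>) ^ n / fact n))" for C t :: real
  using summable_exp[of "2 * c * \<bar>t\<bar>"] by (intro summable_mult) (simp add: field_simps)

lemma suminf_exp_bound: "(\<Sum>n. C * ((2 * c * \<bar>t\<bar>) ^ n / fact n)) = C * exp (2 * c * \<bar>t\<bar>)" for C t :: real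
  using exp_converges[of "2 * c * \<bar>t\<bar>"]
  by (intro sums_unique[symmetric] sums_mult) (simp add: field_simps scaleR_conv_of_real)

lemma summable_exp_series:
  assumes "continuous_on Z f" "x \<in> Z"
  shows "summable (\<lambda>n. \<bar>(generator ^^ n) f x / fact n * t ^ n\<bar>)"
proof -
  obtain C where C: "0 \<le> C" "\<And>x. x \<in> Z \<Longrightarrow> \<bar>f x\<bar> \<le> C"
    using continuous_bounded[OF assms(1)] by blast
  show ?thesis
    by (rule summable_comparison_test'[OF summable_exp_bound[of C t], of 0])
       (simp only: real_norm_def abs_abs exp_series_term_le[OF C(2,1) assms(2)])
qed

lemma abs_exp_series_le:
  assumes f: "continuous_on Z f" and C: "\<And>x. x \<in> Z \<Longrightarrow> \<bar>f x\<bar> \<le> C" "0 \<le> C" and x: "x \<in> Z"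
  shows "\<bar>exp_series f t x\<bar> \<le> C * exp (2 * c * \<bar>t\<bar>)"
proof -
  have "\<bar>exp_series f t x\<bar> \<le> (\<Sum>n. \<bar>(generator ^^ n) f x / fact n * t ^ n\<bar>)"
    unfolding exp_series_def by (rule summable_rabs[OF summable_exp_series[OF f x]])
  also have "\<dots> \<le> (\<Sum>n. C * ((2 * c * \<bar>t\<bar>) ^ n / fact n))"
    by (rule suminf_le[OF exp_series_term_le[OF C x] summable_exp_series[OF f x] summable_exp_bound])
  finally show ?thesis by (simp only: suminf_exp_bound)
qed

lemma continuous_exp_series:
  assumes f: "continuous_on Z f"
  shows "continuous_on Z (exp_series f t)"
proof -
  obtain C where C: "0 \<le> C" "\<And>x. x \<in> Z \<Longrightarrow> \<bar>f x\<bar> \<le> C"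
    using continuous_bounded[OF f] by blast
  have "uniform_limit Z (\<lambda>n x. \<Sum>i<n. (generator ^^ i) f x / fact i * t ^ i) (exp_series f t) sequentially"
    unfolding exp_series_def[abs_def]
    by (rule Weierstrass_m_test[OF _ summable_exp_bound[of C t]])
       (simp only: real_norm_def exp_series_term_le[OF C(2,1)])
  then show ?thesis
    by (rule uniform_limit_theorem[rotated])
       (auto intro!: always_eventually continuous_intros continuous_generator_pow f)
qed

text \<open>The generator is an integral and may be applied termwise, by dominated convergence.\<close>

lemma generator_exp_series:
  assumes f: "continuous_on Z f" and x: "x \<in> Z"
  shows "generator (exp_series f t) x = exp_series (generator f) t x"
proof -
  obtain C where C: "0 \<le> C" "\<And>x. x \<in> Z \<Longrightarrow> \<bar>f x\<bar> \<le> C"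
    using continuous_bounded[OF f] by blast
  let ?a = "\<lambda>n y. (generator ^^ n) f y / fact n * t ^ n"
  have a: "continuous_on Z (?a n)" for n
    by (intro continuous_intros continuous_generator_pow f) auto
  have sums: "(\<lambda>n. \<integral>e. ?a n (J x e) \<partial>E) sums (\<integral>e. exp_series f t (J x e) \<partial>E)"
    unfolding exp_series_def
  proof (rule sums_integral)
    show "integrable E (\<lambda>e. ?a n (J x e))" for n
      using integrable_J[OF x a] .
    show "AE e in E. summable (\<lambda>n. norm (?a n (J x e)))"
      using summable_exp_series[OF f J_in_Z[OF x]] by (intro AE_I2) (simp only: real_norm_def)
    have "norm (\<integral>e. norm (?a n (J x e)) \<partial>E) \<le> C * ((2 * c * \<bar>t\<bar>) ^ n / fact n)" for n
    proof -
      have "\<bar>\<integral>e. norm (?a n (J x e)) \<partial>E\<bar> \<le> C * ((2 * c * \<bar>t\<bar>) ^ n / fact n)"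
        using C(1) rate_pos
        by (intro abs_integral_le) (simp_all only: real_norm_def abs_abs exp_series_term_le[OF C(2,1) J_in_Z[OF x]], simp)
      then show ?thesis by simp
    qed
    then show "summable (\<lambda>n. \<integral>e. norm (?a n (J x e)) \<partial>E)"
      by (intro summable_comparison_test'[OF summable_exp_bound[of C t], of 0])
  qed
  have "(\<lambda>n. ?a n x) sums exp_series f t x"
    unfolding exp_series_def using summable_exp_series[OF f x, of t]
    by (intro summable_sums) (rule summable_rabs_cancel)
  then have "(\<lambda>n. c * ((\<integral>e. ?a n (J x e) \<partial>E) - ?a n x)) sums generator (exp_series f t) x"
    unfolding generator_def[of "exp_series f t"] by (intro sums_mult sums_diff sums)
  also have "(\<lambda>n. c * ((\<integral>e. ?a n (J x e) \<partial>E) - ?a n x)) = (\<lambda>n. (generator ^^ n) (generator f) x / fact n * t ^ n)"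
  proof
    fix n
    have eq: "(generator ^^ n) (generator f) x = c * ((\<integral>e. (generator ^^ n) f (J x e) \<partial>E) - (generator ^^ n) f x)"
      unfolding funpow_swap1[symmetric] by (simp add: generator_def)
    show "c * ((\<integral>e. ?a n (J x e) \<partial>E) - ?a n x) = (generator ^^ n) (generator f) x / fact n * t ^ n"
      unfolding eq by (simp add: algebra_simps diff_divide_distrib)
  qed
  finally show ?thesis
    unfolding exp_series_def[of "generator f"] by (rule sums_unique)
qed

lemma DERIV_exp_series:
  assumes f: "continuous_on Z f" and x: "x \<in> Z"
  shows "((\<lambda>t. exp_series f t x) has_real_derivative exp_series (generator f) t x) (at t)"
proof -
  have "summable (\<lambda>n. (generator ^^ n) f x / fact n * y ^ n)" for y
    using summable_exp_series[OF f x, of y] by (rule summable_rabs_cancel)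
  from termdiffs_strong_converges_everywhere[OF this, of t]
  have "((\<lambda>t. exp_series f t x) has_real_derivative
      (\<Sum>n. diffs (\<lambda>n. (generator ^^ n) f x / fact n) n * t ^ n)) (at t)"
    unfolding exp_series_def .
  also have "diffs (\<lambda>n. (generator ^^ n) f x / fact n) = (\<lambda>n. (generator ^^ n) (generator f) x / fact n)"
  proof
    fix n
    have "(generator ^^ Suc n) f x = (generator ^^ n) (generator f) x"
      by (simp add: funpow_swap1)
    then show "diffs (\<lambda>n. (generator ^^ n) f x / fact n) n = (generator ^^ n) (generator f) x / fact n"
      unfolding diffs_def fact_Suc by (simp add: field_simps del: of_nat_Suc)
  qed
  finally show ?thesis unfolding exp_series_def .
qed

lemma exp_series_diff_le:
  assumes f: "continuous_on Z f" 
  obtains K where "0 \<le> K" "\<And>s x. x \<in> Z \<Longrightarrow> \<bar>s - t\<bar> \<le> 1 \<Longrightarrow> \<bar>exp_series f s x - exp_series f t x\<bar> \<le> K * \<bar>s - t\<bar>"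
proof -
  have g: "continuous_on Z (generator f)" by (rule continuous_generator[OF f])
  obtain C where C: "0 \<le> C" "\<And>x. x \<in> Z \<Longrightarrow> \<bar>generator f x\<bar> \<le> C"
    using continuous_bounded[OF g] by blast
  show ?thesis
  proof (rule that[of "C * exp (2 * c * (\<bar>t\<bar> + 1))"])
    show "0 \<le> C * exp (2 * c * (\<bar>t\<bar> + 1))" using C(1) by simp
    fix s x assume x: "x \<in> Z" and s: "\<bar>s - t\<bar> \<le> 1"
    have "norm (exp_series f s x - exp_series f t x) \<le> C * exp (2 * c * (\<bar>t\<bar> + 1)) * norm (s - t)"
    proof (rule field_differentiable_bound[where S="cball t 1" and f'="\<lambda>u. exp_series (generator f) u x"])
      fix u assume u: "u \<in> cball t 1"
      show "((\<lambda>t. exp_series f t x) has_real_derivative exp_series (generator f) u x) (at u within cball t 1)"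
        by (rule has_field_derivative_at_within[OF DERIV_exp_series[OF f x]])
      have "\<bar>exp_series (generator f) u x\<bar> \<le> C * exp (2 * c * \<bar>u\<bar>)"
        by (rule abs_exp_series_le[OF g C(2,1) x])
      also have "\<dots> \<le> C * exp (2 * c * (\<bar>t\<bar> + 1))"
        using u C(1) rate_pos by (intro mult_left_mono) (auto simp: dist_real_def)
      finally show "norm (exp_series (generator f) u x) \<le> C * exp (2 * c * (\<bar>t\<bar> + 1))" by simp
    qed (use s in \<open>auto simp: dist_real_def abs_minus_commute\<close>)
    then show "\<bar>exp_series f s x - exp_series f t x\<bar> \<le> C * exp (2 * c * (\<bar>t\<bar> + 1)) * \<bar>s - t\<bar>" by simp
  qed
qed

lemma uniform_limitI_abs_le:
  fixes F :: "real \<Rightarrow> 'x \<Rightarrow> real"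
  assumes "0 \<le> K" "\<And>s x. x \<in> Z \<Longrightarrow> s \<noteq> t \<Longrightarrow> \<bar>s - t\<bar> \<le> 1 \<Longrightarrow> \<bar>F s x - l x\<bar> \<le> K * \<bar>s - t\<bar>"
  shows "uniform_limit Z F l (at t within T)"
proof (rule uniform_limitI)
  fix e :: real assume e: "0 < e"
  have "\<forall>\<^sub>F s in at t within T. s \<noteq> t \<and> \<bar>s - t\<bar> < min 1 (e / (K + 1))"
    unfolding eventually_at using e \<open>0 \<le> K\<close>
    by (intro exI[of _ "min 1 (e / (K + 1))"]) (auto simp: dist_real_def)
  then show "\<forall>\<^sub>F s in at t within T. \<forall>x\<in>Z. dist (F s x) (l x) < e"
  proof eventually_elim
    case (elim s)
    have "K * \<bar>s - t\<bar> \<le> (K + 1) * \<bar>s - t\<bar>" by (simp add: mult_right_mono)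
    also have "\<dots> < e" using elim \<open>0 \<le> K\<close> by (simp add: field_simps)
    finally show ?case
      using assms(2)[of _ s] elim by (auto simp: dist_real_def intro: le_less_trans)
  qed
qed

text \<open>Differentiability in the sup norm, as opposed to pointwise, comes from the bound for the second
derivative, which is uniform in \<open>x\<close>: by the mean value theorem the difference quotient differs from
the derivative by at most \<open>K |s - t|\<close> when \<open>|s - t| \<le> 1\<close>.\<close>

theorem has_C1_derivative_exp_series:
  assumes f: "continuous_on Z f"
  shows "has_C1_derivative Z (exp_series f) (exp_series (generator f))"
  unfolding has_C1_derivative_def
proof (intro allI impI conjI)
  fix t :: real
  let ?g = "generator f"
  have g: "continuous_on Z ?g" by (rule continuous_generator[OF f])
  show "continuous_on Z (exp_series f t)" "continuous_on Z (exp_series ?g t)"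
    by (rule continuous_exp_series[OF f], rule continuous_exp_series[OF g])
  obtain K where K: "0 \<le> K" "\<And>s x. x \<in> Z \<Longrightarrow> \<bar>s - t\<bar> \<le> 1 \<Longrightarrow> \<bar>exp_series ?g s x - exp_series ?g t x\<bar> \<le> K * \<bar>s - t\<bar>"
    using exp_series_diff_le[OF g, of t] by blast
  show "uniform_limit Z (exp_series ?g) (exp_series ?g t) (at t within {0..})"
    using K by (intro uniform_limitI_abs_le[of K]) auto
  show "uniform_limit Z (\<lambda>s x. (exp_series f s x - exp_series f t x) / (s - t)) (exp_series ?g t) (at t within {0..})"
  proof (rule uniform_limitI_abs_le[OF K(1)])
    fix s x assume x: "x \<in> Z" and s: "s \<noteq> t" "\<bar>s - t\<bar> \<le> 1"
    let ?d = "exp_series ?g t x"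
    \<comment> \<open>The mean value theorem for \<open>u \<mapsto> exp_series f u x - u * ?d\<close>, whose derivative is small near \<open>t\<close>.\<close>
    have "norm ((exp_series f s x - s * ?d) - (exp_series f t x - t * ?d)) \<le> K * \<bar>s - t\<bar> * norm (s - t)"
    proof (rule field_differentiable_bound[where S="cball t \<bar>s - t\<bar>" and f'="\<lambda>u. exp_series ?g u x - ?d"])
      fix u assume u: "u \<in> cball t \<bar>s - t\<bar>"
      show "((\<lambda>u. exp_series f u x - u * ?d) has_real_derivative exp_series ?g u x - ?d) (at u within cball t \<bar>s - t\<bar>)"
        by (rule has_field_derivative_at_within) (auto intro!: derivative_eq_intros DERIV_exp_series[OF f x])
      have "\<bar>exp_series ?g u x - ?d\<bar> \<le> K * \<bar>u - t\<bar>"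
        using u s by (intro K x) (auto simp: dist_real_def abs_minus_commute)
      also have "\<dots> \<le> K * \<bar>s - t\<bar>"
        using u K(1) by (intro mult_left_mono) (auto simp: dist_real_def abs_minus_commute)
      finally show "norm (exp_series ?g u x - ?d) \<le> K * \<bar>s - t\<bar>" by simp
    qed (auto simp: dist_real_def abs_minus_commute)
    then have "\<bar>exp_series f s x - exp_series f t x - (s - t) * ?d\<bar> \<le> K * \<bar>s - t\<bar> * \<bar>s - t\<bar>"
      by (simp add: algebra_simps)
    moreover have "exp_series f s x - exp_series f t x - (s - t) * ?d =
        ((exp_series f s x - exp_series f t x) / (s - t) - ?d) * (s - t)"
      using s by (simp add: field_simps)
    ultimately have "\<bar>(exp_series f s x - exp_series f t x) / (s - t) - ?d\<bar> * \<bar>s - t\<bar> \<le> K * \<bar>s - t\<bar> * \<bar>s - t\<bar>"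
      by (simp add: abs_mult)
    then show "\<bar>(exp_series f s x - exp_series f t x) / (s - t) - ?d\<bar> \<le> K * \<bar>s - t\<bar>"
      using s by simp
  qed
qed

lemma exp_series_0: "exp_series f 0 x = f x"
  using powser_zero[of "\<lambda>n. (generator ^^ n) f x / fact n"] by (simp add: exp_series_def)

theorem cauchy_solution_exp_series:
  assumes f: "continuous_on Z f"
  shows "cauchy_solution Z generator f (exp_series f)"
  unfolding cauchy_solution_def
  using has_C1_derivative_exp_series[OF f]
  by (intro exI[of _ "exp_series (generator f)"]) (simp add: generator_exp_series[OF f] exp_series_0)

end

section \<open>The first jump equation and uniqueness\<close>

text \<open>Near each time the solution is within a bounded multiple of the distance in time from its value there,
hence locally bounded; compactness of the time interval does the rest.\<close>

lemma has_C1_derivative_bounded: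
  fixes Z :: "'x::topological_space set"
  assumes Z: "compact Z" and h: "has_C1_derivative Z h h'" 
  obtains B where "0 \<le> B" "\<And>t x. t \<in> {0..T} \<Longrightarrow> x \<in> Z \<Longrightarrow> \<bar>h t x\<bar> \<le> B"
proof -
  have "\<exists>\<delta> C. 0 < \<delta> \<and> (\<forall>s\<ge>0. dist t s < \<delta> \<longrightarrow> (\<forall>x\<in>Z. \<bar>h s x\<bar> \<le> C))" if t: "0 \<le> t" for t
  proof -
    have "bounded (h t ` Z)" "bounded (h' t ` Z)"
      using h t Z by (auto simp: has_C1_derivative_def intro!: compact_imp_bounded compact_continuous_image)
    then obtain C C' where C: "\<And>x. x \<in> Z \<Longrightarrow> \<bar>h t x\<bar> \<le> C" "\<And>x. x \<in> Z \<Longrightarrow> \<bar>h' t x\<bar> \<le> C'"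
      by (auto simp: bounded_iff)
    have "uniform_limit Z (\<lambda>s x. (h s x - h t x) / (s - t)) (h' t) (at t within {0..})"
      using h t by (simp add: has_C1_derivative_def)
    then have "\<forall>\<^sub>F s in at t within {0..}. \<forall>x\<in>Z. dist ((h s x - h t x) / (s - t)) (h' t x) < 1"
      by (rule uniform_limitD) simp
    then obtain d where d: "0 < d" "\<And>s x. 0 \<le> s \<Longrightarrow> s \<noteq> t \<Longrightarrow> dist s t < d \<Longrightarrow> x \<in> Z \<Longrightarrow>
        dist ((h s x - h t x) / (s - t)) (h' t x) < 1"
      unfolding eventually_at by auto
    show ?thesis
    proof (rule exI[of _ "min d 1"], rule exI[of _ "C + C' + 1"], intro conjI allI impI ballI)
      show "0 < min d 1" using d(1) by simp
      fix s x assume s: "0 \<le> s" "dist t s < min d 1" and x: "x \<in> Z"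
      show "\<bar>h s x\<bar> \<le> C + C' + 1"
      proof (cases "s = t")
        case True
        then show ?thesis using C(1)[OF x] C(2)[OF x] by simp
      next
        case False
        have "\<bar>(h s x - h t x) / (s - t)\<bar> \<le> C' + 1"
        proof -
          have "dist ((h s x - h t x) / (s - t)) (h' t x) < 1"
            using d(2)[OF s(1) False _ x] s(2) by (simp add: dist_commute)
          then show "\<bar>(h s x - h t x) / (s - t)\<bar> \<le> C' + 1"
            using C(2)[OF x] unfolding dist_real_def by linarith
        qed
        then have "\<bar>h s x - h t x\<bar> \<le> (C' + 1) * \<bar>s - t\<bar>"
          using False by (simp add: divide_le_eq)
        also have "\<dots> \<le> (C' + 1) * 1"
          using s C(2)[OF x] by (intro mult_left_mono) (auto simp: dist_real_def)
        finally show ?thesis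
          using C(1)[OF x] abs_triangle_ineq2[of "h s x" "h t x"] by simp
      qed
    qed
  qed
  then obtain \<delta> C where \<delta>: "\<And>t. 0 \<le> t \<Longrightarrow> 0 < \<delta> t"
    and C: "\<And>t s x. 0 \<le> t \<Longrightarrow> 0 \<le> s \<Longrightarrow> dist t s < \<delta> t \<Longrightarrow> x \<in> Z \<Longrightarrow> \<bar>h s x\<bar> \<le> C t"
    by metis
  obtain D where D: "D \<subseteq> {0..T}" "finite D" "{0..T} \<subseteq> (\<Union>t\<in>D. ball t (\<delta> t))"
  proof (rule compactE_image[OF compact_Icc[of 0 T], of "{0..T}" "\<lambda>t. ball t (\<delta> t)"])
    show "{0..T} \<subseteq> (\<Union>t\<in>{0..T}. ball t (\<delta> t))"
      using \<delta> by auto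
  qed auto
  show ?thesis
  proof (rule that[of "\<Sum>t\<in>D. \<bar>C t\<bar>"])
    fix s x assume s: "s \<in> {0..T}" and x: "x \<in> Z"
    then obtain t where t: "t \<in> D" "dist t s < \<delta> t" using D(3) by auto
    have "\<bar>h s x\<bar> \<le> C t"
      using t s x D(1) by (intro C) auto
    also have "\<dots> \<le> \<bar>C t\<bar>" by simp
    also have "\<dots> \<le> (\<Sum>t\<in>D. \<bar>C t\<bar>)"
      using t(1) D(2) by (intro member_le_sum) auto
    finally show "\<bar>h s x\<bar> \<le> (\<Sum>t\<in>D. \<bar>C t\<bar>)" .
  qed (simp add: sum_nonneg)
qed

lemma has_C1_derivative_DERIV:
  assumes "has_C1_derivative Z h h'" "0 \<le> t" "x \<in> Z"
  shows "((\<lambda>t. h t x) has_real_derivative h' t x) (at t within {0..})"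
  using tendsto_uniform_limitI[where x=x and S=Z and f="\<lambda>s x. (h s x - h t x) / (s - t)" and l="h' t" and F="at t within {0..}"] assms
  by (simp add: has_field_derivative_iff has_C1_derivative_def)

lemma has_C1_derivative_continuous:
  assumes "has_C1_derivative Z h h'" "x \<in> Z"
  shows "continuous_on {0..} (\<lambda>t. h t x)" "continuous_on {0..} (\<lambda>t. h' t x)"
proof -
  show "continuous_on {0..} (\<lambda>t. h t x)"
    using has_C1_derivative_DERIV[OF assms(1) _ assms(2)] by (intro DERIV_continuous_on) auto
  show "continuous_on {0..} (\<lambda>t. h' t x)"
    using assms by (auto simp: continuous_on_def has_C1_derivative_def intro: tendsto_uniform_limitI)
qed

text \<open>A solution is determined by its values on \<open>Z\<close> at nonnegative times, and the operator is only ever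
applied to continuous functions.\<close>

lemma cauchy_solution_cong:
  assumes eq: "\<And>t x. 0 \<le> t \<Longrightarrow> x \<in> Z \<Longrightarrow> h t x = k t x"
    and L: "\<And>t x. 0 \<le> t \<Longrightarrow> x \<in> Z \<Longrightarrow> continuous_on Z (h t) \<Longrightarrow> L (h t) x = L' (k t) x"
    and sol: "cauchy_solution Z L f h"
  shows "cauchy_solution Z L' f k"
proof -
  obtain h' where h': "has_C1_derivative Z h h'"
    and ode: "\<And>t x. 0 \<le> t \<Longrightarrow> x \<in> Z \<Longrightarrow> h' t x - L (h t) x = 0" and init: "\<And>x. x \<in> Z \<Longrightarrow> h 0 x = f x"
    using sol by (auto simp: cauchy_solution_def)
  have cont: "continuous_on Z (h t)" if "0 \<le> t" for t
    using h' that by (simp add: has_C1_derivative_def)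
  have "has_C1_derivative Z k h'"
    unfolding has_C1_derivative_def
  proof (intro allI impI conjI)
    fix t :: real assume t: "0 \<le> t"
    note C1 = h'[unfolded has_C1_derivative_def, rule_format, OF t]
    show "continuous_on Z (k t)" using cont[OF t] by (rule continuous_on_eq) (simp add: eq t)
    show "continuous_on Z (h' t)" "uniform_limit Z h' (h' t) (at t within {0..})" using C1 by auto
    have "\<forall>\<^sub>F s in at t within {0..}. \<forall>x\<in>Z. (h s x - h t x) / (s - t) = (k s x - k t x) / (s - t)"
      by (simp add: eventually_at_filter eq t)
    from uniform_limit_cong[OF this, of "h' t" "h' t"] C1
    show "uniform_limit Z (\<lambda>s x. (k s x - k t x) / (s - t)) (h' t) (at t within {0..})"
      by simp
  qed
  then show ?thesis
    unfolding cauchy_solution_def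
  proof (intro exI[of _ h'] conjI allI impI ballI)
    show "h' t x - L' (k t) x = 0" if "0 \<le> t" "x \<in> Z" for t x
      using ode[OF that] L[OF that cont[OF that(1)]] by simp
    show "k 0 x = f x" if "x \<in> Z" for x
      using init[OF that] eq[of 0 x] that by simp
  qed
qed

context feller_jump_process begin

lemma generator_cong: "(\<And>y. y \<in> Z \<Longrightarrow> f y = g y) \<Longrightarrow> x \<in> Z \<Longrightarrow> generator f x = generator g x"
  unfolding generator_def by (simp add: J_in_Z cong: Bochner_Integration.integral_cong)

lemma measure_Exp_greaterThan: "0 \<le> s \<Longrightarrow> measure Exp {s<..} = exp (- c * s)"
  by (simp add: measure_def emeasure_Exp_greaterThan)

text \<open>Fubini for the first entry of the stream, for bounded functions of arbitrary sign.\<close>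

lemma integral_Clocks:
  fixes f :: "(real \<times> 'e) stream \<Rightarrow> real"
  assumes [measurable]: "f \<in> borel_measurable Clocks" and B: "\<And>\<omega>. \<omega> \<in> space Clocks \<Longrightarrow> \<bar>f \<omega>\<bar> \<le> B"
  shows "(\<integral>\<omega>. f \<omega> \<partial>Clocks) = (\<integral>\<tau>. \<integral>e. \<integral>\<omega>. f ((\<tau>, e) ## \<omega>) \<partial>Clocks \<partial>E \<partial>Exp)"
proof -
  let ?D = "Exp \<Otimes>\<^sub>M E"
  interpret DC: pair_prob_space ?D Clocks ..
  have cons [measurable]: "(\<lambda>(m, \<omega>). m ## \<omega>) \<in> ?D \<Otimes>\<^sub>M Clocks \<rightarrow>\<^sub>M Clocks"
    unfolding Clocks_def by measurable
  have eq: "Clocks = distr (?D \<Otimes>\<^sub>M Clocks) Clocks (\<lambda>(m, \<omega>). m ## \<omega>)"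
  proof (rule measure_eqI)
    fix A assume A [measurable]: "A \<in> sets Clocks"
    have "emeasure Clocks A = (\<integral>\<^sup>+m. \<integral>\<^sup>+\<omega>. indicator A (m ## \<omega>) \<partial>Clocks \<partial>?D)"
      by (subst nn_integral_Clocks[symmetric]) simp_all
    also have "\<dots> = (\<integral>\<^sup>+p. indicator A (case p of (m, \<omega>) \<Rightarrow> m ## \<omega>) \<partial>(?D \<Otimes>\<^sub>M Clocks))"
      by (subst Clocks.nn_integral_fst[symmetric]) simp_all
    also have "\<dots> = (\<integral>\<^sup>+\<omega>. indicator A \<omega> \<partial>distr (?D \<Otimes>\<^sub>M Clocks) Clocks (\<lambda>(m, \<omega>). m ## \<omega>))"
      by (rule nn_integral_distr[symmetric]) measurable
    finally show "emeasure Clocks A = emeasure (distr (?D \<Otimes>\<^sub>M Clocks) Clocks (\<lambda>(m, \<omega>). m ## \<omega>)) A"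
      by simp
  qed simp
  have cons_space: "m ## \<omega> \<in> space Clocks" if "m \<in> space ?D" "\<omega> \<in> space Clocks" for m \<omega>
    using measurable_space[OF cons, of "(m, \<omega>)"] that by (simp add: space_pair_measure)
  have int: "integrable (?D \<Otimes>\<^sub>M Clocks) (\<lambda>p. f (case p of (m, \<omega>) \<Rightarrow> m ## \<omega>))"
    by (rule DC.integrable_const_bound[where B=B]) (auto intro!: AE_I2 B cons_space simp: space_pair_measure)
  have "(\<integral>\<omega>. f \<omega> \<partial>Clocks) = (\<integral>p. f (case p of (m, \<omega>) \<Rightarrow> m ## \<omega>) \<partial>(?D \<Otimes>\<^sub>M Clocks))"
    by (subst eq, rule integral_distr) measurable
  also have "\<dots> = (\<integral>m. \<integral>\<omega>. f (m ## \<omega>) \<partial>Clocks \<partial>?D)"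
    using DC.integral_fst'[OF int] by simp
  also have "\<dots> = (\<integral>\<tau>. \<integral>e. \<integral>\<omega>. f ((\<tau>, e) ## \<omega>) \<partial>Clocks \<partial>E \<partial>Exp)"
    using mark.integral_fst'[OF DC.integrable_fst'[OF int]] by simp
  finally show ?thesis .
qed

lemma abs_integral_Clocks_le:
  assumes [measurable]: "f \<in> borel_measurable Clocks" and B: "\<And>\<omega>. \<omega> \<in> space Clocks \<Longrightarrow> \<bar>f \<omega> :: real\<bar> \<le> B"
  shows "\<bar>\<integral>\<omega>. f \<omega> \<partial>Clocks\<bar> \<le> B"
proof -
  have "\<bar>\<integral>\<omega>. f \<omega> \<partial>Clocks\<bar> \<le> (\<integral>\<omega>. \<bar>f \<omega>\<bar> \<partial>Clocks)" using integral_norm_bound[of Clocks f] by simp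
  also have "\<dots> \<le> (\<integral>\<omega>. B \<partial>Clocks)"
    using B by (intro integral_mono integrable_abs Clocks.integrable_const_bound[where B=B and f=f]) auto
  finally show ?thesis by (simp add: Clocks.prob_space)
qed

lemma measurable_continuous_state:
  assumes "continuous_on Z (f :: 'x \<Rightarrow> real)" "r \<in> borel_measurable N" "g \<in> N \<rightarrow>\<^sub>M restrict_space borel Z" "k \<in> N \<rightarrow>\<^sub>M Clocks"
  shows "(\<lambda>x. f (state J (g x) (r x) (k x))) \<in> borel_measurable N"
  by (rule measurable_compose[OF measurable_state_process[OF assms(2-4)] borel_measurable_continuous_on_restrict[OF assms(1)]])

lemma state_in_Z: "x \<in> Z \<Longrightarrow> \<omega> \<in> space Clocks \<Longrightarrow> state J x t \<omega> \<in> Z"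
  using measurable_space[OF measurable_state_Clocks[of x t], of \<omega>] by simp

lemma integral_transition:
  assumes "continuous_on Z (f :: 'x \<Rightarrow> real)" "x \<in> Z"
  shows "(\<integral>y. f y \<partial>transition t x) = (\<integral>\<omega>. f (state J x t \<omega>) \<partial>Clocks)"
  unfolding transition_def using assms
  by (intro integral_distr measurable_state_Clocks borel_measurable_continuous_on_restrict) simp_all

definition expected :: "('x \<Rightarrow> real) \<Rightarrow> real \<Rightarrow> 'x \<Rightarrow> real" where
  "expected f t x = (\<integral>\<omega>. f (state J x t \<omega>) \<partial>Clocks)"

lemma abs_expected_le:
  assumes "continuous_on Z f" "\<And>x. x \<in> Z \<Longrightarrow> \<bar>f x\<bar> \<le> C" "x \<in> Z"
  shows "\<bar>expected f t x\<bar> \<le> C"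
  unfolding expected_def using assms
  by (intro abs_integral_Clocks_le measurable_continuous_state[OF assms(1)]) (auto intro: state_in_Z)

lemma measurable_expected_J:
  assumes f: "continuous_on Z f" and x: "x \<in> Z"
  shows "case_prod (\<lambda>\<tau> e. expected f (t - \<tau>) (J x e)) \<in> borel_measurable (Exp \<Otimes>\<^sub>M E)"
proof -
  have [measurable]: "J x \<in> E \<rightarrow>\<^sub>M restrict_space borel Z" by (rule measurable_J[OF x])
  have "(\<lambda>p. f (state J (J x (snd (fst p))) (t - fst (fst p)) (snd p))) \<in> borel_measurable ((Exp \<Otimes>\<^sub>M E) \<Otimes>\<^sub>M Clocks)"
    by (intro measurable_continuous_state[OF f]) measurable
  then show ?thesis
    unfolding expected_def split_beta' by (intro Clocks.borel_measurable_lebesgue_integral) (simp add: split_beta')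
qed

lemma measurable_integral_expected_J:
  assumes "continuous_on Z f" "x \<in> Z"
  shows "(\<lambda>\<tau>. \<integral>e. expected f (t - \<tau>) (J x e) \<partial>E) \<in> borel_measurable Exp"
  by (rule borel_measurable_lebesgue_integral[OF measurable_expected_J[OF assms]])

text \<open>Condition on the first entry of the stream: before the first jump the process rests, and after it the
process starts afresh from the new state with the tail of the stream.\<close>

lemma expected_first_jump:
  assumes f: "continuous_on Z f" and x: "x \<in> Z"
  shows "expected f t x = (\<integral>\<tau>. (if t < \<tau> then f x else \<integral>e. expected f (t - \<tau>) (J x e) \<partial>E) \<partial>Exp)"
proof -
  obtain C where C: "0 \<le> C" "\<And>x. x \<in> Z \<Longrightarrow> \<bar>f x\<bar> \<le> C"
    using continuous_bounded[OF f] by blast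
  have "expected f t x = (\<integral>\<tau>. \<integral>e. \<integral>\<omega>. f (state J x t ((\<tau>, e) ## \<omega>)) \<partial>Clocks \<partial>E \<partial>Exp)"
    unfolding expected_def
    using x by (intro integral_Clocks[where B=C] measurable_continuous_state[OF f] C state_in_Z) auto
  also have "\<dots> = (\<integral>\<tau>. (if t < \<tau> then f x else \<integral>e. expected f (t - \<tau>) (J x e) \<partial>E) \<partial>Exp)"
  proof (rule integral_cong_AE)
    have "(\<lambda>p. f (state J x t (fst p ## snd p))) \<in> borel_measurable ((Exp \<Otimes>\<^sub>M E) \<Otimes>\<^sub>M Clocks)"
      using x unfolding Clocks_def
      by (intro measurable_continuous_state[OF f, unfolded Clocks_def]) auto
    then have "case_prod (\<lambda>\<tau> e. \<integral>\<omega>. f (state J x t ((\<tau>, e) ## \<omega>)) \<partial>Clocks) \<in> borel_measurable (Exp \<Otimes>\<^sub>M E)"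
      unfolding split_beta' by (intro Clocks.borel_measurable_lebesgue_integral) (simp add: split_beta')
    then show "(\<lambda>\<tau>. \<integral>e. \<integral>\<omega>. f (state J x t ((\<tau>, e) ## \<omega>)) \<partial>Clocks \<partial>E) \<in> borel_measurable Exp"
      by (rule borel_measurable_lebesgue_integral)
    show "(\<lambda>\<tau>. if t < \<tau> then f x else \<integral>e. expected f (t - \<tau>) (J x e) \<partial>E) \<in> borel_measurable Exp"
      using measurable_integral_expected_J[OF f x, of t] by measurable
    show "AE \<tau> in Exp. (\<integral>e. \<integral>\<omega>. f (state J x t ((\<tau>, e) ## \<omega>)) \<partial>Clocks \<partial>E) =
        (if t < \<tau> then f x else \<integral>e. expected f (t - \<tau>) (J x e) \<partial>E)"
      using AE_Exp_pos
    proof eventually_elim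
      case (elim \<tau>)
      have "(\<integral>\<omega>. f (state J x t ((\<tau>, e) ## \<omega>)) \<partial>Clocks) =
          (if t < \<tau> then f x else expected f (t - \<tau>) (J x e))" if e: "e \<in> space E" for e
      proof -
        have *: "AE \<omega> in Clocks. f (state J x t ((\<tau>, e) ## \<omega>)) =
            (if t < \<tau> then f x else f (state J (J x e) (t - \<tau>) \<omega>))"
          using AE_regular
          by eventually_elim (use elim in \<open>auto simp: regular_Cons state_before_first_jump state_after_first_jump\<close>)
        have "(\<integral>\<omega>. f (state J x t ((\<tau>, e) ## \<omega>)) \<partial>Clocks) =
            (\<integral>\<omega>. (if t < \<tau> then f x else f (state J (J x e) (t - \<tau>) \<omega>)) \<partial>Clocks)"
        proof (rule integral_cong_AE[OF _ _ *])
          have c: "(\<lambda>\<omega>. (\<tau>, e) ## \<omega>) \<in> Clocks \<rightarrow>\<^sub>M Clocks"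
            using e unfolding Clocks_def
            by (intro measurable_Stream measurable_const) (auto simp: space_pair_measure)
          show "(\<lambda>\<omega>. f (state J x t ((\<tau>, e) ## \<omega>))) \<in> borel_measurable Clocks"
            using x by (intro measurable_continuous_state[OF f] c) auto
          have "(\<lambda>\<omega>. f (state J (J x e) (t - \<tau>) \<omega>)) \<in> borel_measurable Clocks"
            using J_in_Z[OF x e] by (intro measurable_continuous_state[OF f]) auto
          then show "(\<lambda>\<omega>. if t < \<tau> then f x else f (state J (J x e) (t - \<tau>) \<omega>)) \<in> borel_measurable Clocks"
            by simp
        qed
        then show ?thesis
          by (simp add: expected_def Clocks.prob_space)
      qed
      then have "(\<integral>e. \<integral>\<omega>. f (state J x t ((\<tau>, e) ## \<omega>)) \<partial>Clocks \<partial>E) =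
          (\<integral>e. (if t < \<tau> then f x else expected f (t - \<tau>) (J x e)) \<partial>E)"
        by (intro Bochner_Integration.integral_cong) auto
      then show ?case by (simp add: prob_space)
    qed
  qed
  finally show ?thesis .
qed

text \<open>Variation of constants: \<open>s \<mapsto> exp(- c s) h(t - s, x)\<close> has the derivative
\<open>- c exp(- c s) (P h(t - s))(x)\<close> because \<open>h' = c (P h - h)\<close>. Integrating over \<open>[0, t]\<close> and reading
\<open>c exp(- c s)\<close> as the density of the first waiting time gives the equation. Integrating over
the mark first and then over the waiting time avoids any question of joint measurability of \<open>h\<close> in
time and space.\<close>

lemma cauchy_solution_first_jump:
  assumes h: "cauchy_solution Z generator f h" and t: "0 \<le> t" and x: "x \<in> Z"
  defines "g \<equiv> \<lambda>\<tau>. if t < \<tau> then f x else \<integral>e. h (t - \<tau>) (J x e) \<partial>E"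
  shows "has_bochner_integral Exp g (h t x)"
proof -
  obtain h' where C1: "has_C1_derivative Z h h'"
    and eq: "\<And>t x. 0 \<le> t \<Longrightarrow> x \<in> Z \<Longrightarrow> h' t x = generator (h t) x"
    and init: "\<And>x. x \<in> Z \<Longrightarrow> h 0 x = f x"
    using h by (auto simp: cauchy_solution_def)
  define \<psi> where "\<psi> s = c * exp (- c * s) * (\<integral>e. h (t - s) (J x e) \<partial>E)" for s
  have \<psi>: "\<psi> s = exp (- c * s) * (h' (t - s) x + c * h (t - s) x)" if "s \<le> t" for s
    using that eq[of "t - s" x] x by (simp add: \<psi>_def generator_def algebra_simps)
  have deriv: "((\<lambda>s. - (exp (- c * s) * h (t - s) x)) has_vector_derivative \<psi> s) (at s within {0..t})"
    if "0 \<le> s" "s \<le> t" for s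
  proof -
    have "((\<lambda>s. h (t - s) x) has_real_derivative h' (t - s) x * (- 1)) (at s within {0..t})"
    proof (rule DERIV_image_chain[of "\<lambda>s. h s x" _ "\<lambda>s. t - s", unfolded comp_def])
      show "((-) t has_real_derivative - 1) (at s within {0..t})"
        by (auto intro!: derivative_eq_intros)
      show "((\<lambda>s. h s x) has_real_derivative h' (t - s) x) (at (t - s) within (-) t ` {0..t})"
        using has_C1_derivative_DERIV[OF C1, of "t - s" x] that x
        by (auto intro: has_field_derivative_subset)
    qed
    then have "((\<lambda>s. - (exp (- c * s) * h (t - s) x)) has_real_derivative \<psi> s) (at s within {0..t})"
      by (auto intro!: derivative_eq_intros simp: \<psi>[OF that(2)] algebra_simps)
    then show ?thesis by (simp add: has_real_derivative_iff_has_vector_derivative)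
  qed
  have "continuous_on {..t} (\<lambda>s. h' (t - s) x / c + h (t - s) x)"
    using rate_pos
    by (intro continuous_intros continuous_on_compose2[OF has_C1_derivative_continuous(1)[OF C1 x]]
          continuous_on_compose2[OF has_C1_derivative_continuous(2)[OF C1 x]]) auto
  then have cont_P: "continuous_on {..t} (\<lambda>s. \<integral>e. h (t - s) (J x e) \<partial>E)"
  proof (rule continuous_on_eq)
    fix s assume "s \<in> {..t}"
    then show "h' (t - s) x / c + h (t - s) x = (\<integral>e. h (t - s) (J x e) \<partial>E)"
      using eq[of "t - s" x] x rate_pos by (simp add: generator_def field_simps)
  qed
  then have cont: "continuous_on {0..t} \<psi>"
    unfolding \<psi>_def by (intro continuous_intros) (auto intro: continuous_on_subset)
  have "has_bochner_integral lborel (\<lambda>s. indicator {0..t} s *\<^sub>R \<psi> s)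
      (- (exp (- c * t) * h (t - t) x) - - (exp (- c * 0) * h (t - 0) x))"
    by (rule has_bochner_integral_FTC_Icc[OF t deriv cont]) auto
  then have I1: "has_bochner_integral lborel (\<lambda>s. indicator {0..t} s *\<^sub>R \<psi> s) (h t x - exp (- c * t) * f x)"
    using init[OF x] by simp
  have "has_bochner_integral Exp (\<lambda>s. indicator {t<..} s *\<^sub>R f x) (measure Exp {t<..} *\<^sub>R f x)"
    by (rule has_bochner_integral_indicator) (auto simp: less_top[symmetric])
  then have I2: "has_bochner_integral Exp (\<lambda>s. indicator {t<..} s *\<^sub>R f x) (exp (- c * t) * f x)"
    using t by (simp add: measure_Exp_greaterThan)
  have I3: "has_bochner_integral Exp (\<lambda>s. indicator {..t} s *\<^sub>R (\<integral>e. h (t - s) (J x e) \<partial>E)) (h t x - exp (- c * t) * f x)"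
    unfolding Exp_def
  proof (rule has_bochner_integral_density)
    show "(\<lambda>s. indicator {..t} s *\<^sub>R (\<integral>e. h (t - s) (J x e) \<partial>E)) \<in> borel_measurable lborel"
      using borel_measurable_continuous_on_indicator[OF _ cont_P] by simp
    have "(\<lambda>s. exponential_density c s *\<^sub>R indicator {..t} s *\<^sub>R (\<integral>e. h (t - s) (J x e) \<partial>E)) =
        (\<lambda>s. indicator {0..t} s *\<^sub>R \<psi> s)"
      by (auto simp: \<psi>_def exponential_density_def indicator_def mult.commute)
    then show "has_bochner_integral lborel
        (\<lambda>s. exponential_density c s *\<^sub>R indicator {..t} s *\<^sub>R (\<integral>e. h (t - s) (J x e) \<partial>E))
        (h t x - exp (- c * t) * f x)"
      using I1 by simp
  qed (use rate_pos in \<open>auto simp: exponential_density_nonneg\<close>)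
  have "g = (\<lambda>s. indicator {t<..} s *\<^sub>R f x + indicator {..t} s *\<^sub>R (\<integral>e. h (t - s) (J x e) \<partial>E))"
    by (auto simp: g_def indicator_def)
  then show ?thesis
    using has_bochner_integral_add[OF I2 I3] by simp
qed

text \<open>Both sides satisfy the first jump equation, in which they coincide unless a jump occurs. Iterating the
equation \<open>n\<close> times multiplies the bound for the difference on \<open>[0, T]\<close> by \<open>q\<^sup>n\<close>, where \<open>q < 1\<close> is the
probability of a jump before \<open>T\<close>.\<close>

theorem cauchy_solution_eq_expected:
  assumes f: "continuous_on Z f" and h: "cauchy_solution Z generator f h" and "0 \<le> T" "x \<in> Z"
  shows "h T x = expected f T x"
proof -
  obtain h' where C1: "has_C1_derivative Z h h'"
    using h by (auto simp: cauchy_solution_def)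
  have cont: "continuous_on Z (h t)" if "0 \<le> t" for t
    using C1 that by (simp add: has_C1_derivative_def)
  obtain B where B: "0 \<le> B" "\<And>t x. t \<in> {0..T} \<Longrightarrow> x \<in> Z \<Longrightarrow> \<bar>h t x\<bar> \<le> B"
    using has_C1_derivative_bounded[OF compact_Z C1, of T] by blast
  obtain C where C: "0 \<le> C" "\<And>x. x \<in> Z \<Longrightarrow> \<bar>f x\<bar> \<le> C"
    using continuous_bounded[OF f] by blast
  define q where "q = 1 - exp (- c * T)"
  have q: "0 \<le> q" "q < 1" using rate_pos \<open>0 \<le> T\<close> by (auto simp: q_def)
  have "\<bar>h t x - expected f t x\<bar> \<le> q ^ n * (B + C)" if "t \<in> {0..T}" "x \<in> Z" for n t x
    using that
  proof (induction n arbitrary: t x)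
    case 0
    then show ?case
      using B(2)[of t x] abs_expected_le[OF f C(2), of x t] by simp
  next
    case (Suc n)
    let ?R = "q ^ n * (B + C)"
    have R: "0 \<le> ?R" using q B(1) C(1) by simp
    let ?h = "\<lambda>\<tau>. if t < \<tau> then f x else \<integral>e. h (t - \<tau>) (J x e) \<partial>E"
    let ?m = "\<lambda>\<tau>. if t < \<tau> then f x else \<integral>e. expected f (t - \<tau>) (J x e) \<partial>E"
    have I: "has_bochner_integral Exp ?h (h t x)"
      using cauchy_solution_first_jump[OF h] Suc.prems by simp
    have m: "integrable Exp ?m"
    proof (rule Exp.integrable_const_bound[where B=C])
      show "?m \<in> borel_measurable Exp"
        using measurable_integral_expected_J[OF f Suc.prems(2), of t] by measurable
      show "AE \<tau> in Exp. norm (?m \<tau>) \<le> C"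
        using C Suc.prems(2) abs_expected_le[OF f C(2)]
        by (intro AE_I2) (auto intro!: abs_integral_le J_in_Z)
    qed
    have "h t x - expected f t x = (\<integral>\<tau>. ?h \<tau> \<partial>Exp) - (\<integral>\<tau>. ?m \<tau> \<partial>Exp)"
      using I by (simp add: has_bochner_integral_integral_eq expected_first_jump[OF f Suc.prems(2), of t])
    also have "\<dots> = (\<integral>\<tau>. ?h \<tau> - ?m \<tau> \<partial>Exp)"
      using I m by (intro Bochner_Integration.integral_diff[symmetric]) (auto simp: has_bochner_integral_iff)
    finally have eq: "h t x - expected f t x = (\<integral>\<tau>. ?h \<tau> - ?m \<tau> \<partial>Exp)" .
    have "\<bar>?h \<tau> - ?m \<tau>\<bar> \<le> indicator {0<..t} \<tau> * ?R" if "0 < \<tau>" for \<tau>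
    proof (cases "t < \<tau>")
      case False
      have t': "t - \<tau> \<in> {0..T}" using False that Suc.prems(1) by auto
      have "integrable E (\<lambda>e. expected f (t - \<tau>) (J x e))"
      proof (rule integrable_const_bound[where B=C])
        show "(\<lambda>e. expected f (t - \<tau>) (J x e)) \<in> borel_measurable E"
          using measurable_compose[OF measurable_Pair1'[of \<tau> Exp E] measurable_expected_J[OF f Suc.prems(2), of t]] by simp
        show "AE e in E. norm (expected f (t - \<tau>) (J x e)) \<le> C"
          using abs_expected_le[OF f C(2)] J_in_Z[OF Suc.prems(2)] by (intro AE_I2) simp
      qed
      moreover have "integrable E (\<lambda>e. h (t - \<tau>) (J x e))"
        using t' by (intro integrable_J Suc.prems(2) cont) simp
      ultimately have "?h \<tau> - ?m \<tau> = (\<integral>e. h (t - \<tau>) (J x e) - expected f (t - \<tau>) (J x e) \<partial>E)"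
        using False by simp
      moreover have "\<bar>\<integral>e. h (t - \<tau>) (J x e) - expected f (t - \<tau>) (J x e) \<partial>E\<bar> \<le> ?R"
        using R by (intro abs_integral_le Suc.IH t' J_in_Z[OF Suc.prems(2)])
      ultimately show ?thesis using False that by simp
    qed simp
    then have AE: "AE \<tau> in Exp. \<bar>?h \<tau> - ?m \<tau>\<bar> \<le> indicator {0<..t} \<tau> * ?R"
      by (rule eventually_mono[OF AE_Exp_pos])
    have "\<bar>h t x - expected f t x\<bar> \<le> (\<integral>\<tau>. \<bar>?h \<tau> - ?m \<tau>\<bar> \<partial>Exp)"
      unfolding eq using integral_norm_bound[of Exp "\<lambda>\<tau>. ?h \<tau> - ?m \<tau>"] by simp
    also have "\<dots> \<le> (\<integral>\<tau>. indicator {0<..t} \<tau> * ?R \<partial>Exp)"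
      using I m AE integrable_real_indicator[of "{0<..t}" Exp] Exp.emeasure_finite[of "{0<..t}"]
      by (intro integral_mono_AE integrable_abs Bochner_Integration.integrable_diff)
         (auto simp: has_bochner_integral_iff less_top[symmetric])
    also have "\<dots> = measure Exp {0<..t} * ?R" by simp
    finally have *: "\<bar>h t x - expected f t x\<bar> \<le> measure Exp {0<..t} * ?R" .
    have "measure Exp {0<..t} \<le> measure Exp (space Exp - {t<..})"
      by (rule Exp.finite_measure_mono) auto
    also have "\<dots> = 1 - exp (- c * t)"
      using Suc.prems(1) by (subst Exp.prob_compl) (auto simp: measure_Exp_greaterThan)
    also have "\<dots> \<le> q"
      using Suc.prems(1) rate_pos by (simp add: q_def)
    finally have "measure Exp {0<..t} \<le> q" .
    then have "measure Exp {0<..t} * ?R \<le> q * ?R" using R by (rule mult_right_mono)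
    with * show ?case by simp
  qed
  then have "\<bar>h T x - expected f T x\<bar> \<le> q ^ n * (B + C)" for n
    using assms(3,4) by simp
  moreover have "(\<lambda>n. q ^ n * (B + C)) \<longlonglongrightarrow> 0"
    using q by (intro tendsto_mult_left_zero LIMSEQ_power_zero) simp
  ultimately have "\<bar>h T x - expected f T x\<bar> \<le> 0"
    by (intro LIMSEQ_le_const) auto
  then show ?thesis by simp
qed

theorem
  assumes f: "continuous_on Z f"
  shows cauchy_solution_transition: "cauchy_solution Z generator f (\<lambda>t x. \<integral>y. f y \<partial>transition t x)"
    and cauchy_solution_unique:
      "cauchy_solution Z generator f h \<Longrightarrow> 0 \<le> t \<Longrightarrow> x \<in> Z \<Longrightarrow> h t x = (\<integral>y. f y \<partial>transition t x)"
proof -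
  have expected: "(\<integral>y. f y \<partial>transition t x) = expected f t x" if "x \<in> Z" for t x
    using integral_transition[OF f that] by (simp add: expected_def)
  show "h t x = (\<integral>y. f y \<partial>transition t x)" if "cauchy_solution Z generator f h" "0 \<le> t" "x \<in> Z" for h t x
    using cauchy_solution_eq_expected[OF f that] expected[OF that(3)] by simp
  have eq: "exp_series f t x = (\<integral>y. f y \<partial>transition t x)" if "0 \<le> t" "x \<in> Z" for t x
    using cauchy_solution_eq_expected[OF f cauchy_solution_exp_series[OF f] that] expected[OF that(2)] by simp
  show "cauchy_solution Z generator f (\<lambda>t x. \<integral>y. f y \<partial>transition t x)"
  proof (rule cauchy_solution_cong[OF eq])
    show "generator (exp_series f t) x = generator (\<lambda>x. \<integral>y. f y \<partial>transition t x) x"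
      if "0 \<le> t" "x \<in> Z" for t x
      using eq[OF that(1)] that(2) by (rule generator_cong)
    show "cauchy_solution Z generator f (exp_series f)"
      by (rule cauchy_solution_exp_series[OF f])
  qed
qed

end

section \<open>Jump processes with a continuous kernel\<close>

lemma compact_countable_dense:
  fixes Z :: "'a::metric_space set"
  assumes "compact Z"
  obtains D where "countable D" "D \<subseteq> Z" "\<And>x r. x \<in> Z \<Longrightarrow> 0 < r \<Longrightarrow> \<exists>d\<in>D. dist x d < r"
proof -
  have "\<exists>D\<subseteq>Z. finite D \<and> Z \<subseteq> (\<Union>d\<in>D. ball d (1 / real (Suc n)))" for n
    by (rule compactE_image[OF assms, of Z "\<lambda>d. ball d (1 / real (Suc n))"]) auto
  then obtain D where D: "\<And>n. D n \<subseteq> Z" "\<And>n. finite (D n)" "\<And>n. Z \<subseteq> (\<Union>d\<in>D n. ball d (1 / real (Suc n)))"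
    by metis
  show ?thesis
  proof (rule that[of "\<Union>n. D n"])
    show "countable (\<Union>n. D n)" using D(2) by (auto intro: countable_finite)
    show "(\<Union>n. D n) \<subseteq> Z" using D(1) by blast
    fix x and r :: real assume x: "x \<in> Z" and "0 < r"
    then obtain n where n: "1 / real (Suc n) < r" using nat_approx_posE by blast
    obtain d where "d \<in> D n" "dist d x < 1 / real (Suc n)" using D(3)[of n] x by auto
    then show "\<exists>d\<in>\<Union>n. D n. dist x d < r"
      using n by (auto simp: dist_commute intro!: bexI[of _ d] exI[of _ n])
  qed
qed

text \<open>Open subsets of \<open>Z \<times> Z\<close> belong to the product sigma-algebra because \<open>Z\<close> is separable, although the
ambient space need not be. The proof expresses \<open>a < K x y\<close> by countably many conditions, each
involving \<open>x\<close> and \<open>y\<close> separately: there are points \<open>d\<close> of a countable dense set arbitrarily close to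
\<open>x\<close> for which \<open>K d y\<close> exceeds \<open>a\<close> by a fixed amount.\<close>

lemma borel_measurable_pair_continuous:
  fixes Z :: "'a::metric_space set" and K :: "'a \<Rightarrow> 'a \<Rightarrow> real"
  assumes Z: "compact Z" and K: "continuous_on (Z \<times> Z) (\<lambda>(x, y). K x y)"
  shows "(\<lambda>(x, y). K x y) \<in> borel_measurable (restrict_space borel Z \<Otimes>\<^sub>M restrict_space borel Z)"
proof -
  let ?S = "restrict_space borel Z"
  have space: "space ?S = Z" by (simp add: space_restrict_space)
  obtain D where D: "countable D" "D \<subseteq> Z" and dense: "\<And>x r. x \<in> Z \<Longrightarrow> 0 < r \<Longrightarrow> \<exists>d\<in>D. dist x d < r"
    using compact_countable_dense[OF Z] by blast
  have K1: "continuous_on Z (\<lambda>x. K x y)" if "y \<in> Z" for y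
    by (rule continuous_on_compose2[OF K, of Z "\<lambda>x. (x, y)", unfolded prod.case])
       (use that in \<open>auto intro!: continuous_intros\<close>)
  have K2: "(\<lambda>y. K x y) \<in> borel_measurable ?S" if "x \<in> Z" for x
    by (rule borel_measurable_continuous_on_restrict,
        rule continuous_on_compose2[OF K, of Z "\<lambda>y. (x, y)", unfolded prod.case])
       (use that in \<open>auto intro!: continuous_intros\<close>)
  have dist_meas: "(\<lambda>x. dist x d) \<in> borel_measurable ?S" for d
    by (intro borel_measurable_continuous_on_restrict continuous_intros)
  have char: "a < K x y \<longleftrightarrow> (\<exists>k. \<forall>n. \<exists>d\<in>D. dist x d < 1 / real (Suc n) \<and> a + 1 / real (Suc k) < K d y)"
    if x: "x \<in> Z" and y: "y \<in> Z" for a x y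
  proof
    assume "a < K x y"
    then obtain k where k: "1 / real (Suc k) < K x y - a" using nat_approx_posE[of "K x y - a"] by auto
    show "\<exists>k. \<forall>n. \<exists>d\<in>D. dist x d < 1 / real (Suc n) \<and> a + 1 / real (Suc k) < K d y"
    proof (intro exI[of _ k] allI)
      fix n
      have "\<exists>\<delta>>0. \<forall>d\<in>Z. dist d x < \<delta> \<longrightarrow> dist (K d y) (K x y) < K x y - a - 1 / real (Suc k)"
        using K1[OF y] x k unfolding continuous_on_iff by (metis diff_gt_0_iff_gt)
      then obtain \<delta> where \<delta>: "0 < \<delta>" "\<And>d. d \<in> Z \<Longrightarrow> dist d x < \<delta> \<Longrightarrow> dist (K d y) (K x y) < K x y - a - 1 / real (Suc k)"
        by auto
      obtain d where d: "d \<in> D" "dist x d < min \<delta> (1 / real (Suc n))"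
        using dense[OF x, of "min \<delta> (1 / real (Suc n))"] \<delta>(1) by auto
      then have "dist (K d y) (K x y) < K x y - a - 1 / real (Suc k)"
        using D(2) by (intro \<delta>) (auto simp: dist_commute)
      then show "\<exists>d\<in>D. dist x d < 1 / real (Suc n) \<and> a + 1 / real (Suc k) < K d y"
        using d by (intro bexI[of _ d]) (auto simp: dist_real_def)
    qed
  next
    assume "\<exists>k. \<forall>n. \<exists>d\<in>D. dist x d < 1 / real (Suc n) \<and> a + 1 / real (Suc k) < K d y"
    then obtain k d where d: "\<And>n. d n \<in> D" "\<And>n. dist x (d n) < 1 / real (Suc n)"
      "\<And>n. a + 1 / real (Suc k) < K (d n) y"
      by metis
    have "d \<longlonglongrightarrow> x"
    proof (rule metric_tendsto_imp_tendsto[OF LIMSEQ_inverse_real_of_nat])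
      show "\<forall>\<^sub>F n in sequentially. dist (d n) x \<le> dist (inverse (real (Suc n))) 0"
        using d(2) by (intro always_eventually) (simp add: dist_commute inverse_eq_divide less_imp_le)
    qed
    then have "(\<lambda>n. K (d n) y) \<longlonglongrightarrow> K x y"
      using K1[OF y] x d(1) D(2) by (auto simp: continuous_on_sequentially comp_def)
    then have "a + 1 / real (Suc k) \<le> K x y"
      using d(3) by (intro LIMSEQ_le_const) (auto intro: less_imp_le)
    then show "a < K x y" by (rule less_le_trans[rotated]) simp
  qed
  show ?thesis
  proof (subst borel_measurable_iff_greater, intro allI)
    fix a
    have "{p \<in> space (?S \<Otimes>\<^sub>M ?S). a < (\<lambda>(x, y). K x y) p} =
        {p \<in> space (?S \<Otimes>\<^sub>M ?S). \<exists>k. \<forall>n. \<exists>d\<in>D. dist (fst p) d < 1 / real (Suc n) \<and> a + 1 / real (Suc k) < K d (snd p)}"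
    proof (intro Collect_cong conj_cong refl)
      fix p assume "p \<in> space (?S \<Otimes>\<^sub>M ?S)"
      then have "fst p \<in> Z" "snd p \<in> Z" by (auto simp: space_pair_measure space)
      from char[OF this, of a]
      show "a < (\<lambda>(x, y). K x y) p \<longleftrightarrow>
          (\<exists>k. \<forall>n. \<exists>d\<in>D. dist (fst p) d < 1 / real (Suc n) \<and> a + 1 / real (Suc k) < K d (snd p))"
        unfolding split_beta' .
    qed
    also have "\<dots> \<in> sets (?S \<Otimes>\<^sub>M ?S)"
    proof -
      have [measurable]: "(\<lambda>p. dist (fst p) d) \<in> borel_measurable (?S \<Otimes>\<^sub>M ?S)" for d
        by (rule measurable_compose[OF measurable_fst dist_meas])
      have [measurable]: "(\<lambda>p. K d (snd p)) \<in> borel_measurable (?S \<Otimes>\<^sub>M ?S)" if "d \<in> D" for d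
        using that D(2) by (intro measurable_compose[OF measurable_snd K2]) auto
      have [measurable]: "Measurable.pred (?S \<Otimes>\<^sub>M ?S)
          (\<lambda>p. \<exists>d\<in>D. dist (fst p) d < 1 / real (Suc n) \<and> a + 1 / real (Suc k) < K d (snd p))" for n k
      proof -
        let ?Q = "\<lambda>d p. dist (fst p) d < 1 / real (Suc n) \<and> a + 1 / real (Suc k) < K d (snd p)"
        have "{p \<in> space (?S \<Otimes>\<^sub>M ?S). ?Q d p} \<in> sets (?S \<Otimes>\<^sub>M ?S)" if [measurable]: "d \<in> D" for d
          by measurable
        then have "(\<Union>d\<in>D. {p \<in> space (?S \<Otimes>\<^sub>M ?S). ?Q d p}) \<in> sets (?S \<Otimes>\<^sub>M ?S)"
          by (intro sets.countable_UN' D(1) image_subsetI)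
        also have "(\<Union>d\<in>D. {p \<in> space (?S \<Otimes>\<^sub>M ?S). ?Q d p}) = {p \<in> space (?S \<Otimes>\<^sub>M ?S). \<exists>d\<in>D. ?Q d p}"
          by auto
        finally show ?thesis by (simp add: pred_def)
      qed
      have "Measurable.pred (?S \<Otimes>\<^sub>M ?S)
          (\<lambda>p. \<exists>k. \<forall>n. \<exists>d\<in>D. dist (fst p) d < 1 / real (Suc n) \<and> a + 1 / real (Suc k) < K d (snd p))"
        by measurable
      then show ?thesis by (simp add: pred_def)
    qed
    finally show "{p \<in> space (?S \<Otimes>\<^sub>M ?S). a < (\<lambda>(x, y). K x y) p} \<in> sets (?S \<Otimes>\<^sub>M ?S)" .
  qed
qed

text \<open>Thinning: let \<open>\<kappa>\<close> be an upper bound for the kernel and \<open>\<mu>\<close> the total mass of \<open>m\<close>. Jumps are proposed at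
rate \<open>\<kappa> \<mu>\<close>, with target \<open>v\<close> drawn from the normalised measure, and a proposal to move from \<open>x\<close> to \<open>v\<close>
is accepted with probability \<open>K x v / \<kappa>\<close>. A rejected proposal leaves the state unchanged and does not
contribute to the generator, so moves from \<open>x\<close> happen at the rate \<open>K x v dm(v)\<close>.\<close>

theorem ex_feller_jump_process:
  fixes Z :: "'a::metric_space set" and K :: "'a \<Rightarrow> 'a \<Rightarrow> real" and m :: "'a measure"
  assumes Z: "compact Z" and m: "finite_measure m" "sets m = sets (restrict_space borel Z)"
    and K: "continuous_on (Z \<times> Z) (\<lambda>(x, y). K x y)"
    and K_nonneg: "\<And>x y. x \<in> Z \<Longrightarrow> y \<in> Z \<Longrightarrow> 0 \<le> K x y"
  obtains E :: "('a \<times> real) measure" and J :: "'a \<Rightarrow> 'a \<times> real \<Rightarrow> 'a" and c :: real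
  where "feller_jump_process E Z J c"
    and "\<And>f x. continuous_on Z f \<Longrightarrow> x \<in> Z \<Longrightarrow>
      feller_jump_process.generator E J c f x = (\<integral>y. K x y * (f y - f x) \<partial>m)"
proof (cases "measure m (space m) = 0")
  case True
  \<comment> \<open>For the null measure, which cannot be normalised, every jump goes nowhere.\<close>
  let ?E = "return (count_space UNIV) undefined :: ('a \<times> real) measure"
  interpret E: prob_space ?E by (rule prob_space_return) simp
  interpret feller_jump_process ?E Z "\<lambda>x _. x" 1
    using E.prob_space by unfold_locales (simp_all add: Z)
  interpret m: finite_measure m by fact
  have "AE y in m. False"
    using True m.emeasure_eq_measure by (intro AE_I[where N="space m"]) auto
  then have "(\<integral>y. K x y * (f y - f x) \<partial>m) = 0" for f x
    by (intro integral_eq_zero_AE) auto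
  then show ?thesis
    by (intro that[of ?E "\<lambda>x _. x" 1] feller_jump_process_axioms) (use E.prob_space in \<open>simp add: generator_def\<close>)
next
  case False
  interpret m: finite_measure m by fact
  let ?S = "restrict_space borel Z"
  have space_S: "space ?S = Z" by (simp add: space_restrict_space)
  have space_m: "space m = Z" using sets_eq_imp_space_eq[OF m(2)] space_S by simp
  define \<mu> where "\<mu> = measure m (space m)"
  have \<mu>: "0 < \<mu>" using False by (simp add: \<mu>_def zero_less_measure_iff)
  note [measurable_cong] = m(2)
  have "bounded ((\<lambda>(x, y). K x y) ` (Z \<times> Z))"
    by (intro compact_imp_bounded compact_continuous_image K compact_Times Z)
  then obtain B where B: "\<And>x y. x \<in> Z \<Longrightarrow> y \<in> Z \<Longrightarrow> \<bar>K x y\<bar> \<le> B"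
    by (force simp: bounded_iff)
  define \<kappa> where "\<kappa> = \<bar>B\<bar> + 1"
  have \<kappa>: "0 < \<kappa>" "\<And>x y. x \<in> Z \<Longrightarrow> y \<in> Z \<Longrightarrow> K x y \<le> \<kappa>"
    using B by (fastforce simp: \<kappa>_def)+
  define V where "V = density m (\<lambda>_. ennreal (1 / \<mu>))"
  define U where "U = uniform_measure lborel {0..1::real}"
  define J where "J = (\<lambda>x (v, w). if w * \<kappa> \<le> K x v then v else x)"
  have [measurable_cong]: "sets V = sets ?S" "sets U = sets borel"
    using m(2) by (simp_all add: V_def U_def)
  have space_V: "space V = Z" and space_U: "space U = UNIV"
    by (simp_all add: V_def U_def space_m)
  interpret V: prob_space V
  proof
    have "emeasure V (space V) = ennreal (1 / \<mu>) * emeasure m (space m)"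
      by (simp add: V_def emeasure_density nn_integral_cmult)
    also have "\<dots> = 1"
      using \<mu> by (simp add: m.emeasure_eq_measure \<mu>_def[symmetric] ennreal_mult[symmetric])
    finally show "emeasure V (space V) = 1" .
  qed
  interpret U: prob_space U
    unfolding U_def by (rule prob_space_uniform_measure) simp_all
  interpret VU: pair_prob_space V U ..
  have [measurable]: "(\<lambda>(x, y). K x y) \<in> borel_measurable (?S \<Otimes>\<^sub>M ?S)"
    by (rule borel_measurable_pair_continuous[OF Z K])
  have J_meas: "(\<lambda>(x, e). J x e) \<in> ?S \<Otimes>\<^sub>M (V \<Otimes>\<^sub>M U) \<rightarrow>\<^sub>M ?S"
    unfolding J_def split_beta' by measurable
  have K_meas [measurable]: "K x \<in> borel_measurable ?S" if "x \<in> Z" for x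
    using measurable_compose[OF measurable_Pair1'[of x ?S ?S], of "\<lambda>(x, y). K x y" borel] that space_S
    by simp
  have U_le: "measure U {..p} = p" if "0 \<le> p" "p \<le> 1" for p
  proof -
    have "{0..1} \<inter> {..p} = {0..p}" using that by auto
    then show ?thesis using that by (simp add: U_def measure_uniform_measure)
  qed
  have E: "(\<integral>e. f (J x e) \<partial>(V \<Otimes>\<^sub>M U)) = f x + (1 / (\<kappa> * \<mu>)) * (\<integral>y. K x y * (f y - f x) \<partial>m)"
    if f: "continuous_on Z f" and x: "x \<in> Z" for f :: "'a \<Rightarrow> real" and x
  proof -
    have f_meas [measurable]: "f \<in> borel_measurable ?S"
      using f by (rule borel_measurable_continuous_on_restrict)
    have "bounded (f ` Z)"
      using f Z by (intro compact_imp_bounded compact_continuous_image)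
    then obtain C where C: "\<And>x. x \<in> Z \<Longrightarrow> \<bar>f x\<bar> \<le> C"
      by (auto simp: bounded_iff)
    have KC: "\<bar>K x y * (f y - f x)\<bar> \<le> \<kappa> * (2 * C)" if "y \<in> Z" for y
      unfolding abs_mult using \<kappa> x that K_nonneg C[OF x] C[OF that] by (intro mult_mono) auto
    have int: "integrable m (\<lambda>y. K x y * (f y - f x))"
      using x KC by (intro m.integrable_const_bound[where B="\<kappa> * (2 * C)"] AE_I2) (auto simp: space_m)
    have [measurable]: "J x \<in> V \<Otimes>\<^sub>M U \<rightarrow>\<^sub>M ?S"
      using measurable_compose[OF measurable_Pair1'[of x ?S "V \<Otimes>\<^sub>M U"] J_meas] x space_S by simp
    have "integrable (V \<Otimes>\<^sub>M U) (\<lambda>e. f (J x e))"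
    proof (rule VU.integrable_const_bound[where B=C])
      show "AE e in V \<Otimes>\<^sub>M U. norm (f (J x e)) \<le> C"
        using x by (intro AE_I2) (auto simp: J_def space_pair_measure space_V intro!: C)
    qed measurable
    from VU.integral_fst'[OF this]
    have "(\<integral>e. f (J x e) \<partial>(V \<Otimes>\<^sub>M U)) = (\<integral>v. \<integral>w. f (J x (v, w)) \<partial>U \<partial>V)" by simp
    also have "\<dots> = (\<integral>v. f x + K x v * (f v - f x) / \<kappa> \<partial>V)"
    proof (intro Bochner_Integration.integral_cong refl)
      fix v assume "v \<in> space V"
      then have v: "v \<in> Z" by (simp add: space_V)
      have "(\<integral>w. f (J x (v, w)) \<partial>U) = (\<integral>w. f x + indicator {..K x v / \<kappa>} w * (f v - f x) \<partial>U)"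
        using \<kappa>(1) by (intro Bochner_Integration.integral_cong refl) (auto simp: J_def indicator_def field_simps)
      also have "\<dots> = f x + measure U {..K x v / \<kappa>} * (f v - f x)"
        by (subst Bochner_Integration.integral_add)
           (use U.prob_space in \<open>auto simp: less_top[symmetric] space_U\<close>)
      also have "measure U {..K x v / \<kappa>} = K x v / \<kappa>"
        using \<kappa> K_nonneg x v by (intro U_le) auto
      finally show "(\<integral>w. f (J x (v, w)) \<partial>U) = f x + K x v * (f v - f x) / \<kappa>" by simp
    qed
    also have "\<dots> = (\<integral>v. (1 / \<mu>) * (f x + K x v * (f v - f x) / \<kappa>) \<partial>m)"
      unfolding V_def using \<mu> x by (subst integral_density) auto
    also have "\<dots> = (1 / \<mu>) * (\<mu> * f x + (\<integral>v. K x v * (f v - f x) \<partial>m) / \<kappa>)"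
      using int by (simp add: \<mu>_def)
    also have "\<dots> = f x + (1 / (\<kappa> * \<mu>)) * (\<integral>y. K x y * (f y - f x) \<partial>m)"
      using \<mu> \<kappa>(1) by (simp add: field_simps)
    finally show "(\<integral>e. f (J x e) \<partial>(V \<Otimes>\<^sub>M U)) = f x + (1 / (\<kappa> * \<mu>)) * (\<integral>y. K x y * (f y - f x) \<partial>m)" .
  qed
  \<comment> \<open>The map \<open>J\<close> is in general discontinuous in \<open>x\<close>; the formula for its average shows continuity.\<close>
  have feller: "continuous_on Z (\<lambda>x. \<integral>e. f (J x e) \<partial>(V \<Otimes>\<^sub>M U))" if f: "continuous_on Z f" for f :: "'a \<Rightarrow> real"
  proof -
    have "bounded (f ` Z)"
      using f Z by (intro compact_imp_bounded compact_continuous_image)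
    then obtain C where C: "\<And>x. x \<in> Z \<Longrightarrow> \<bar>f x\<bar> \<le> C"
      by (auto simp: bounded_iff)
    have f_meas [measurable]: "f \<in> borel_measurable ?S"
      using f by (rule borel_measurable_continuous_on_restrict)
    have "continuous_on Z (\<lambda>x. \<integral>y. K x y * (f y - f x) \<partial>m)"
      unfolding continuous_on_sequentially comp_def
    proof (intro allI ballI impI, elim conjE)
      fix u x assume x: "x \<in> Z" and u: "\<forall>n. u n \<in> Z" "u \<longlonglongrightarrow> x"
      show "(\<lambda>n. \<integral>y. K (u n) y * (f y - f (u n)) \<partial>m) \<longlonglongrightarrow> (\<integral>y. K x y * (f y - f x) \<partial>m)"
      proof (rule integral_dominated_convergence[where w="\<lambda>_. \<kappa> * (2 * C)"])
        show "AE y in m. (\<lambda>n. K (u n) y * (f y - f (u n))) \<longlonglongrightarrow> K x y * (f y - f x)"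
        proof (intro AE_I2 tendsto_intros)
          fix y assume "y \<in> space m"
          then have y: "y \<in> Z" by (simp add: space_m)
          have "(\<lambda>n. (u n, y)) \<longlonglongrightarrow> (x, y)" by (intro tendsto_intros u)
          then show "(\<lambda>n. K (u n) y) \<longlonglongrightarrow> K x y"
            using continuous_on_tendsto_compose[OF K, of "\<lambda>n. (u n, y)" "(x, y)" sequentially] x y u(1) by simp
          show "(\<lambda>n. f (u n)) \<longlonglongrightarrow> f x"
            using continuous_on_tendsto_compose[OF f u(2) x] u(1) by simp
        qed
        show "AE y in m. norm (K (u n) y * (f y - f (u n))) \<le> \<kappa> * (2 * C)" for n
        proof (rule AE_I2)
          fix y assume "y \<in> space m"
          then have y: "y \<in> Z" by (simp add: space_m)
          show "norm (K (u n) y * (f y - f (u n))) \<le> \<kappa> * (2 * C)"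
            unfolding real_norm_def abs_mult using \<kappa> u(1) y K_nonneg C[OF y] C[of "u n"] by (intro mult_mono) auto
        qed
      qed (use x u(1) in auto)
    qed
    then have "continuous_on Z (\<lambda>x. f x + (1 / (\<kappa> * \<mu>)) * (\<integral>y. K x y * (f y - f x) \<partial>m))"
      by (intro continuous_intros f)
    then show ?thesis
      by (rule continuous_on_eq) (simp add: E[OF f])
  qed
  interpret feller_jump_process "V \<Otimes>\<^sub>M U" Z J "\<kappa> * \<mu>"
    by unfold_locales (use Z \<kappa>(1) \<mu> J_meas feller in auto)
  show ?thesis
    using \<mu> \<kappa>(1) by (intro that[OF feller_jump_process_axioms]) (simp add: generator_def E)
qed

section \<open>The kernel of a verticial covering\<close>

context nonarch_local_field begin

lemma disc_eq_cball: "{x. absK (x - a) \<le> r} = cball a r"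
  by (auto simp: dist_abs[symmetric] dist_commute)

lemma dist_ultrametric: "dist x z \<le> max (dist x y) (dist y z)" for x y z :: 'a
  using abs_ultrametric[of "x - y" "y - z"] by (simp add: dist_abs)

text \<open>By the ultrametric inequality every point of a disc is a centre of it.\<close>

lemma is_disc_clopen:
  assumes "is_disc absK D"
  shows "open D" "closed D"
proof -
  obtain a r where r: "0 < r" and D: "D = cball a r"
    using assms by (auto simp: is_disc_def disc_eq_cball)
  show "closed D" by (simp add: D)
  have "ball y r \<subseteq> cball a r" if "y \<in> cball a r" for y
  proof
    fix x assume "x \<in> ball y r"
    then show "x \<in> cball a r"
      using dist_ultrametric[of a x y] that by auto
  qed
  then show "open D"
    unfolding D open_contains_ball using r by blast
qed

lemma is_holed_disc_open:
  assumes "is_holed_disc absK U"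
  shows "open U"
proof -
  obtain D \<H> where D: "is_disc absK D" "finite \<H>" "\<forall>H\<in>\<H>. is_disc absK H" "U = D - \<Union>\<H>"
    using assms by (auto simp: is_holed_disc_def)
  then show ?thesis
    unfolding D(4) using is_disc_clopen by (intro open_Diff closed_Union) blast+
qed

lemma verticial_covering_open: "verticial_covering absK \<U> Z \<Longrightarrow> U \<in> \<U> \<Longrightarrow> open U"
  by (auto simp: verticial_covering_def intro: is_holed_disc_open)

text \<open>Compactness yields a finite subcover; by disjointness it can only miss the empty set, which is a
possible member of the covering.\<close>

lemma verticial_covering_finite:
  assumes "verticial_covering absK \<U> Z" "compact Z"
  shows "finite \<U>"
proof -
  have cov: "\<Union>\<U> = Z" "disjoint \<U>" using assms(1) by (auto simp: verticial_covering_def)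
  obtain \<V> where \<V>: "\<V> \<subseteq> \<U>" "finite \<V>" "Z \<subseteq> \<Union>\<V>"
    using compactE[OF assms(2), of \<U>] cov(1) verticial_covering_open[OF assms(1)] by blast
  have "\<U> \<subseteq> insert {} \<V>"
  proof
    fix U assume U: "U \<in> \<U>"
    show "U \<in> insert {} \<V>"
    proof (cases "U = {}")
      case False
      then obtain x where x: "x \<in> U" by auto
      then obtain V where V: "V \<in> \<V>" "x \<in> V" using U cov(1) \<V>(3) by blast
      then have "U = V" using cov(2) x U \<V>(1) by (auto simp: disjoint_def)
      then show ?thesis using V by simp
    qed simp
  qed
  then show ?thesis using \<V>(2) finite_subset by blast
qed

lemma kernel_on_block:
  assumes "finite \<U>" "disjoint \<U>" "U \<in> \<U>" "V \<in> \<U>" "x \<in> U" "y \<in> V"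
  shows "kernel absK \<alpha> A \<U> x y = A U V * dist x y powr \<alpha>"
proof -
  have ind: "indicator W z = (if W = W' then 1 else 0 :: real)" if "W \<in> \<U>" "W' \<in> \<U>" "z \<in> W'" for W W' z
    using that assms(2) by (auto simp: disjoint_def indicator_def)
  have "kernel absK \<alpha> A \<U> x y =
      (\<Sum>U'\<in>\<U>. \<Sum>V'\<in>\<U>. if V' = V then (if U' = U then A U' V' * dist x y powr \<alpha> else 0) else 0)"
    unfolding kernel_def dist_abs
    by (intro sum.cong refl) (use ind[OF _ assms(3,5)] ind[OF _ assms(4,6)] in auto)
  also have "\<dots> = A U V * dist x y powr \<alpha>"
    using assms(1,3,4) by simp
  finally show ?thesis .
qed

text \<open>On each of the open sets \<open>U \<times> V\<close> the kernel is \<open>A\<^sub>U\<^sub>V |x - y|\<^sup>\<alpha>\<close>. For \<open>U = V\<close> this vanishes, and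
for \<open>U \<noteq> V\<close> the two sets are disjoint, so that the distance is positive; this covers negative
exponents too.\<close>

lemma continuous_kernel:
  assumes cov: "verticial_covering absK \<U> Z" and Z: "compact Z"
    and diag: "\<And>U. U \<in> \<U> \<Longrightarrow> A U U = 0"
  shows "continuous_on (Z \<times> Z) (\<lambda>(x, y). kernel absK \<alpha> A \<U> x y)"
proof -
  have \<U>: "\<Union>\<U> = Z" "disjoint \<U>" "finite \<U>"
    using cov verticial_covering_finite[OF cov Z] by (auto simp: verticial_covering_def)
  have "continuous_on (\<Union>((\<lambda>(U, V). U \<times> V) ` (\<U> \<times> \<U>))) (\<lambda>(x, y). kernel absK \<alpha> A \<U> x y)"
  proof (rule continuous_on_open_Union; clarify)
    fix U V assume U: "U \<in> \<U>" and V: "V \<in> \<U>"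
    show "open (U \<times> V)"
      using verticial_covering_open[OF cov] U V by (intro open_Times)
    have "continuous_on (U \<times> V) (\<lambda>(x, y). A U V * dist x y powr \<alpha>)"
    proof (cases "U = V")
      case True
      then show ?thesis using diag[OF U] by (simp add: split_beta')
    next
      case False
      then have "x \<noteq> y" if "x \<in> U" "y \<in> V" for x y
        using that U V \<U>(2) by (auto simp: disjoint_def)
      then show ?thesis
        unfolding split_beta' by (intro continuous_intros) (force simp: mem_Times_iff)
    qed
    then show "continuous_on (U \<times> V) (\<lambda>(x, y). kernel absK \<alpha> A \<U> x y)"
      by (rule continuous_on_eq) (auto simp: kernel_on_block[OF \<U>(3,2) U V])
  qed
  also have "\<Union>((\<lambda>(U, V). U \<times> V) ` (\<U> \<times> \<U>)) = Z \<times> Z"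
    using \<U>(1) by blast
  finally show ?thesis .
qed

lemma kernel_nonneg:
  assumes "\<And>U V. U \<in> \<U> \<Longrightarrow> V \<in> \<U> \<Longrightarrow> 0 \<le> A U V"
  shows "0 \<le> kernel absK \<alpha> A \<U> x y"
  unfolding kernel_def by (intro sum_nonneg mult_nonneg_nonneg assms) auto

end

section \<open>The Cauchy problem and its Markov process\<close>

theorem theorem5p19:
  fixes absK :: "'a::{field,metric_space} \<Rightarrow> real"
    and \<mu> :: "'a measure"
    and Z :: "'a set"
    and \<U> :: "'a set set"
    and A :: "'a set \<Rightarrow> 'a set \<Rightarrow> real"
    and \<alpha> \<epsilon> :: real
  assumes "nonarch_local_field absK"
    and "normalized_haar_measure absK \<mu>"
    and "compact Z" and "closed Z" and "open Z"
    and "verticial_covering absK \<U> Z"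
    and "\<And>U V. U \<in> \<U> \<Longrightarrow> V \<in> \<U> \<Longrightarrow> A U V = A V U"
    and "\<And>U V. U \<in> \<U> \<Longrightarrow> V \<in> \<U> \<Longrightarrow> 0 \<le> A U V"
    and "\<And>U. U \<in> \<U> \<Longrightarrow> A U U = 0"
    and "\<epsilon> > 0"
  shows "\<exists>p :: real \<Rightarrow> 'a \<Rightarrow> 'a measure.
    (\<forall>t\<ge>0. \<forall>x\<in>Z. prob_space (p t x) \<and> sets (p t x) = sets (restrict_space borel Z)) \<and>
    (\<forall>h0. continuous_on Z h0 \<longrightarrow>
       cauchy_solution Z (\<lambda>f x. \<epsilon> * diff_op absK \<mu> Z \<alpha> A \<U> f x) h0 (\<lambda>t x. \<integral>y. h0 y \<partial>p t x) \<and>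
       (\<forall>h. cauchy_solution Z (\<lambda>f x. \<epsilon> * diff_op absK \<mu> Z \<alpha> A \<U> f x) h0 h \<longrightarrow>
          (\<forall>t\<ge>0. \<forall>x\<in>Z. h t x = (\<integral>y. h0 y \<partial>p t x)))) \<and>
    (\<exists>(M :: (real \<Rightarrow> 'a) measure) F P X.
       markov_process (restrict_space borel Z) p M F P X \<and>
       (\<forall>\<omega>\<in>space M. cadlag_path Z (\<lambda>t. X t \<omega>)))"
proof -
  interpret nonarch_local_field absK by fact
  let ?S = "restrict_space borel Z"
  let ?L = "\<lambda>f x. \<epsilon> * diff_op absK \<mu> Z \<alpha> A \<U> f x"
  define K where "K x y = \<epsilon> * kernel absK \<alpha> A \<U> x y" for x y
  define m where "m = restrict_space \<mu> Z"
  have \<mu>: "sets \<mu> = sets borel" "emeasure \<mu> Z < \<infinity>"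
    using assms(2,3) by (auto simp: normalized_haar_measure_def)
  have Z: "Z \<in> sets borel" using assms(4) by (rule borel_closed)
  have "emeasure m (space m) = emeasure \<mu> Z"
    using \<mu> Z by (simp add: m_def emeasure_restrict_space space_restrict_space sets_eq_imp_space_eq[OF \<mu>(1)])
  then have "finite_measure m"
    using \<mu>(2) by (intro finite_measureI) simp
  moreover have "sets m = sets ?S"
    unfolding m_def by (rule sets_restrict_space_cong[OF \<mu>(1)])
  moreover have "continuous_on (Z \<times> Z) (\<lambda>(x, y). K x y)"
    unfolding K_def split_beta'
    using continuous_kernel[where A=A and \<alpha>=\<alpha>, OF assms(6,3,9)]
    by (intro continuous_intros) (simp add: split_beta')
  moreover have "0 \<le> K x y" for x y
    unfolding K_def using assms(8,10) by (intro mult_nonneg_nonneg kernel_nonneg) auto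
  ultimately obtain E :: "('a \<times> real) measure" and J c
    where "feller_jump_process E Z J c"
      and gen: "\<And>f x. continuous_on Z f \<Longrightarrow> x \<in> Z \<Longrightarrow>
        feller_jump_process.generator E J c f x = (\<integral>y. K x y * (f y - f x) \<partial>m)"
    using ex_feller_jump_process[OF assms(3), of m K] by blast
  then interpret feller_jump_process E Z J c by simp
  have L: "generator f x = ?L f x" if "continuous_on Z f" "x \<in> Z" for f x
  proof -
    have "generator f x = \<epsilon> * (\<integral>y. indicator Z y *\<^sub>R (kernel absK \<alpha> A \<U> x y * (f y - f x)) \<partial>\<mu>)"
      using \<mu>(1) Z gen[OF that]
      by (simp add: m_def K_def integral_restrict_space sets_eq_imp_space_eq[OF \<mu>(1)] mult.assoc)
    then show ?thesis by (simp add: diff_op_def set_lebesgue_integral_def)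
  qed
  let ?\<Omega> = "{\<gamma>. cadlag_path Z \<gamma>}"
  let ?M = "coordinate_algebra ?\<Omega> ?S {0..}"
  have "markov_process ?S transition ?M (\<lambda>t. coordinate_algebra ?\<Omega> ?S {0..t})
      (\<lambda>x. distr Clocks ?M (\<lambda>\<omega> t. state J x t \<omega>)) (\<lambda>t \<gamma>. \<gamma> t)"
  proof (rule markov_process_jump_process)
    show "(\<lambda>t. state J x t \<omega>) \<in> ?\<Omega>" if "x \<in> space ?S" "\<omega> \<in> space Clocks" for x \<omega>
      using embedded_chain_in_space[OF J that(1), of \<omega>] that(2) sets_eq_imp_space_eq[OF sets_Clocks]
      by (auto intro!: cadlag_path_state)
    show "\<gamma> t \<in> space ?S" if "\<gamma> \<in> ?\<Omega>" "0 \<le> t" for \<gamma> t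
      using that by (simp add: cadlag_path_def)
    show "{x} \<in> sets ?S" if "x \<in> space ?S" for x
      using that by (auto simp: sets_restrict_space image_iff intro!: bexI[of _ "{x}"])
  qed
  moreover have "cauchy_solution Z ?L h0 (\<lambda>t x. \<integral>y. h0 y \<partial>transition t x)" if "continuous_on Z h0" for h0
    using cauchy_solution_transition[OF that] by (rule cauchy_solution_cong[rotated 2]) (simp_all add: L)
  moreover have "h t x = (\<integral>y. h0 y \<partial>transition t x)"
    if "continuous_on Z h0" "cauchy_solution Z ?L h0 h" "0 \<le> t" "x \<in> Z" for h0 h t x
  proof -
    have "cauchy_solution Z generator h0 h"
      using that(2) by (rule cauchy_solution_cong[rotated 2]) (simp_all add: L)
    then show ?thesis using cauchy_solution_unique[OF that(1)] that(3,4) by blast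
  qed
  ultimately show ?thesis
    by (intro exI[of _ transition] conjI exI[of _ ?M]
          exI[of _ "\<lambda>t. coordinate_algebra ?\<Omega> ?S {0..t}"]
          exI[of _ "\<lambda>x. distr Clocks ?M (\<lambda>\<omega> t. state J x t \<omega>)"] exI[of _ "\<lambda>t \<gamma>. \<gamma> t"])
       (auto simp: prob_space_transition)
qed

end
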